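(* Let $\varphi:M^2\to N^n$ be a biconservative surface in a Riemannian manifold. Then $$\frac12\Delta|S_2|^2=-2K|S_2|^2+\operatorname{div}\left(\left(\langle S_2,\operatorname{grad}(|\tau(\varphi)|^2)\rangle\right)^\sharp\right)+K|\tau(\varphi)|^4+\frac12\Delta\left(|\tau(\varphi)|^4\right)+\left|\operatorname{grad}\left(|\tau(\varphi)|^2\right)\right|^2-|\nabla S_2|^2,$$ where $K$ is the Gaussian curvature of $M$.
   Context: All manifolds, metrics and maps are smooth; all manifolds are connected and oriented. A surface $\varphi:M^2\to N^n$ is a Riemannian (isometric) immersion of a 2-dimensional Riemannian manifold into a Riemannian manifold. $B$ is the second fundamental form, $H=\frac12\operatorname{trace}B$ the mean curvature vector field, $\tau(\varphi)=2H$ the tension field, and $A_H$ the shape operator in the direction of $H$, with $\langle A_H(X),Y\rangle=\langle B(X,Y),H\rangle$. The stress-bienergy tensor of a surface is the symmetric $(1,1)$-tensor field $S_2=-2|H|^2I+4A_H$ ($I$ the identity), and $M$ is biconservative if $\operatorname{div}S_2=0$, where $\operatorname{div}T=\sum_i(\nabla_{X_i}T)(X_i)$ for a local orthonormal frame $\{X_i\}$. The Laplacian on functions is $\Delta=-\operatorname{trace}\nabla^2=-\operatorname{div}\operatorname{grad}$. $(\langle S_2,\operatorname{grad}f\rangle)^\sharp$ is the vector field dual to the 1-form $X\mapsto\langle S_2(X),\operatorname{grad}f\rangle$, i.e. $S_2(\operatorname{grad}f)$. Norms are the tensor norms: $|S_2|^2=\sum_i|S_2(X_i)|^2$ and $|\nabla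 S_2|^2=\sum_{i,j}|(\nabla_{X_i}S_2)(X_j)|^2$. *)

theory Defs
  imports "HOL-Analysis.Analysis"
begin

section \<open>Smooth functions on open subsets of Euclidean space\<close>

primrec differentiable_upto ::
  "nat \<Rightarrow> 'a::real_normed_vector set \<Rightarrow> ('a \<Rightarrow> 'b::real_normed_vector) \<Rightarrow> bool" where
  "differentiable_upto 0 S f \<longleftrightarrow> continuous_on S f"
| "differentiable_upto (Suc k) S f \<longleftrightarrow>
     (\<forall>x\<in>S. f differentiable (at x)) \<and>
     (\<forall>v. differentiable_upto k S (\<lambda>x. frechet_derivative f (at x) v))"

definition smooth_on :: "'a::real_normed_vector set \<Rightarrow> ('a \<Rightarrow> 'b::real_normed_vector) \<Rightarrow> bool" where
  "smooth_on S f \<longleftrightarrow> (\<forall>k. differentiable_upto k S f)"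


section \<open>Connected oriented Riemannian manifolds\<close>

record ('m, 'n) chart =
  cdom :: "'m set"
  cmap :: "'m \<Rightarrow> real^'n"

definition cimage :: "('m, 'n::finite) chart \<Rightarrow> (real^'n) set" where
  "cimage c = cmap c ` cdom c"

definition cinv :: "('m, 'n::finite) chart \<Rightarrow> real^'n \<Rightarrow> 'm" where
  "cinv c = inv_into (cdom c) (cmap c)"

text \<open>A tangent vector at a point is a derivation on the functions that are smooth near that point.\<close>
type_synonym 'm tangent_vector = "('m \<Rightarrow> real) \<Rightarrow> real"

text \<open>The points are those of \<open>topspace (mtop M)\<close>, the dimension is \<open>CARD('n)\<close>, and
  \<open>atlas\<close> need not be maximal.\<close>
record ('m, 'n) riemannian =
  mtop :: "'m topology"
  atlas :: "('m, 'n) chart set"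
  rmetric :: "'m \<Rightarrow> 'm tangent_vector \<Rightarrow> 'm tangent_vector \<Rightarrow> real"

definition transition :: "('m, 'n::finite) chart \<Rightarrow> ('m, 'n) chart \<Rightarrow> real^'n \<Rightarrow> real^'n" where
  "transition c d = cmap d \<circ> cinv c"

definition oriented_smooth_manifold :: "('m, 'n::finite, 'z) riemannian_scheme \<Rightarrow> bool" where
  "oriented_smooth_manifold M \<longleftrightarrow>
     Hausdorff_space (mtop M) \<and>
     second_countable (mtop M) \<and>
     connected_space (mtop M) \<and>
     (\<Union>c\<in>atlas M. cdom c) = topspace (mtop M) \<and>
     (\<forall>c\<in>atlas M. openin (mtop M) (cdom c) \<and> open (cimage c) \<and>
        homeomorphic_map (subtopology (mtop M) (cdom c)) (top_of_set (cimage c)) (cmap c)) \<and>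
     (\<forall>c\<in>atlas M. \<forall>d\<in>atlas M.
        smooth_on (cmap c ` (cdom c \<inter> cdom d)) (transition c d) \<and>
        (\<forall>x\<in>cmap c ` (cdom c \<inter> cdom d).
           0 < det (matrix (frechet_derivative (transition c d) (at x)))))"

definition smooth_near :: "('m, 'n::finite, 'z) riemannian_scheme \<Rightarrow> 'm \<Rightarrow> ('m \<Rightarrow> real) \<Rightarrow> bool" where
  "smooth_near M p f \<longleftrightarrow>
     (\<exists>V. openin (mtop M) V \<and> p \<in> V \<and>
        (\<forall>c\<in>atlas M. smooth_on (cmap c ` (V \<inter> cdom c)) (f \<circ> cinv c)))"

text \<open>The vector at \<open>p\<close> with components \<open>u\<close> in the chart \<open>c\<close>. Setting it to \<open>0\<close> off the
  functions smooth near \<open>p\<close> makes equality of tangent vectors independent of the chart used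
  to write them.\<close>
definition coord_vector ::
  "('m, 'n::finite, 'z) riemannian_scheme \<Rightarrow> ('m, 'n) chart \<Rightarrow> 'm \<Rightarrow> real^'n \<Rightarrow> 'm tangent_vector" where
  "coord_vector M c p u =
     (\<lambda>f. if smooth_near M p f then frechet_derivative (f \<circ> cinv c) (at (cmap c p)) u else 0)"

definition tangent_space :: "('m, 'n::finite, 'z) riemannian_scheme \<Rightarrow> 'm \<Rightarrow> 'm tangent_vector set" where
  "tangent_space M p = {coord_vector M c p u | c u. c \<in> atlas M \<and> p \<in> cdom c}"

definition local_metric ::
  "('m, 'n::finite, 'z) riemannian_scheme \<Rightarrow> ('m, 'n) chart \<Rightarrow> real^'n \<Rightarrow> real^'n \<Rightarrow> real^'n \<Rightarrow> real" where
  "local_metric M c x u v =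
     rmetric M (cinv c x) (coord_vector M c (cinv c x) u) (coord_vector M c (cinv c x) v)"

definition riemannian_manifold :: "('m, 'n::finite, 'z) riemannian_scheme \<Rightarrow> bool" where
  "riemannian_manifold M \<longleftrightarrow>
     oriented_smooth_manifold M \<and>
     (\<forall>c\<in>atlas M.
        (\<forall>x\<in>cimage c. bilinear (local_metric M c x) \<and>
           (\<forall>u v. local_metric M c x u v = local_metric M c x v u) \<and>
           (\<forall>u. u \<noteq> 0 \<longrightarrow> 0 < local_metric M c x u u)) \<and>
        (\<forall>u v. smooth_on (cimage c) (\<lambda>x. local_metric M c x u v)))"


section \<open>Isometric immersions\<close>

definition local_dom ::
  "('m \<Rightarrow> 'p) \<Rightarrow> ('m, 'a::finite) chart \<Rightarrow> ('p, 'b::finite) chart \<Rightarrow> (real^'a) set" where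
  "local_dom \<phi> c d = {x \<in> cimage c. \<phi> (cinv c x) \<in> cdom d}"

definition local_map ::
  "('m \<Rightarrow> 'p) \<Rightarrow> ('m, 'a::finite) chart \<Rightarrow> ('p, 'b::finite) chart \<Rightarrow> real^'a \<Rightarrow> real^'b" where
  "local_map \<phi> c d = cmap d \<circ> \<phi> \<circ> cinv c"

definition smooth_map ::
  "('m, 'a::finite, 'y) riemannian_scheme \<Rightarrow> ('p, 'b::finite, 'z) riemannian_scheme \<Rightarrow>
   ('m \<Rightarrow> 'p) \<Rightarrow> bool" where
  "smooth_map M N \<phi> \<longleftrightarrow>
     continuous_map (mtop M) (mtop N) \<phi> \<and>
     (\<forall>c\<in>atlas M. \<forall>d\<in>atlas N. smooth_on (local_dom \<phi> c d) (local_map \<phi> c d))"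

definition differential ::
  "('p, 'b::finite, 'z) riemannian_scheme \<Rightarrow> ('m \<Rightarrow> 'p) \<Rightarrow> 'm \<Rightarrow>
   'm tangent_vector \<Rightarrow> 'p tangent_vector" where
  "differential N \<phi> p v = (\<lambda>f. if smooth_near N (\<phi> p) f then v (f \<circ> \<phi>) else 0)"

text \<open>Since the metric of \<open>M\<close> is positive definite, the last condition forces the
  differentials to be injective.\<close>
definition isometric_immersion ::
  "('m, 'a::finite, 'y) riemannian_scheme \<Rightarrow> ('p, 'b::finite, 'z) riemannian_scheme \<Rightarrow>
   ('m \<Rightarrow> 'p) \<Rightarrow> bool" where
  "isometric_immersion M N \<phi> \<longleftrightarrow>
     smooth_map M N \<phi> \<and>
     (\<forall>p\<in>topspace (mtop M). \<forall>v\<in>tangent_space M p. \<forall>w\<in>tangent_space M p.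
        rmetric N (\<phi> p) (differential N \<phi> p v) (differential N \<phi> p w) = rmetric M p v w)"


section \<open>Riemannian geometry in a chart\<close>

text \<open>All objects below are fields on a chart domain, written in the coordinates of that chart:
  \<open>g x u v\<close> is the metric at the point with coordinates \<open>x\<close>; vector fields and (1,1)-tensor fields are given by their components, \<open>X x\<close> and \<open>T x u\<close> respectively.
  A vector \<open>w\<close> at \<open>x\<close> extends to the coordinate field \<open>\<lambda>_. w\<close>; such fields commute.\<close>

type_synonym 'n local_metric = "real^'n \<Rightarrow> real^'n \<Rightarrow> real^'n \<Rightarrow> real"

definition sharp :: "'n::finite local_metric \<Rightarrow> real^'n \<Rightarrow> (real^'n \<Rightarrow> real) \<Rightarrow> real^'n" where
  "sharp g x \<omega> = (THE z. \<forall>w. g x z w = \<omega> w)"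

text \<open>Koszul formula for commuting fields; \<open>christoffel g x e\<^sub>i e\<^sub>j\<close> has the components
  \<open>\<Gamma>\<close> of the Levi-Civita connection.\<close>
definition christoffel :: "'n::finite local_metric \<Rightarrow> real^'n \<Rightarrow> real^'n \<Rightarrow> real^'n \<Rightarrow> real^'n" where
  "christoffel g x u v = sharp g x (\<lambda>w.
     (frechet_derivative (\<lambda>y. g y v w) (at x) u
      + frechet_derivative (\<lambda>y. g y u w) (at x) v
      - frechet_derivative (\<lambda>y. g y u v) (at x) w) / 2)"

definition nabla :: "'n::finite local_metric \<Rightarrow> real^'n \<Rightarrow> (real^'n \<Rightarrow> real^'n) \<Rightarrow> real^'n \<Rightarrow> real^'n" where
  "nabla g u Y x = frechet_derivative Y (at x) u + christoffel g x u (Y x)"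

text \<open>\<open>(\<nabla>\<^sub>u T) v = \<nabla>\<^sub>u (T V) - T (\<nabla>\<^sub>u V)\<close> for any field \<open>V\<close> extending \<open>v\<close>\<close>
definition nabla_tensor ::
  "'n::finite local_metric \<Rightarrow> real^'n \<Rightarrow> (real^'n \<Rightarrow> real^'n \<Rightarrow> real^'n) \<Rightarrow> real^'n \<Rightarrow> real^'n \<Rightarrow> real^'n" where
  "nabla_tensor g u T x v = nabla g u (\<lambda>y. T y v) x - T x (nabla g u (\<lambda>_. v) x)"

definition orthonormal_basis :: "'n::finite local_metric \<Rightarrow> real^'n \<Rightarrow> ('n \<Rightarrow> real^'n) \<Rightarrow> bool" where
  "orthonormal_basis g x e \<longleftrightarrow> (\<forall>i j. g x (e i) (e j) = (if i = j then 1 else 0))"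

text \<open>The traces below do not depend on the orthonormal basis.\<close>
definition onb :: "'n::finite local_metric \<Rightarrow> real^'n \<Rightarrow> 'n \<Rightarrow> real^'n" where
  "onb g x = (SOME e. orthonormal_basis g x e)"

definition metric_trace ::
  "'n::finite local_metric \<Rightarrow> real^'n \<Rightarrow> (real^'n \<Rightarrow> real^'n \<Rightarrow> 'b::real_vector) \<Rightarrow> 'b" where
  "metric_trace g x \<beta> = (\<Sum>i\<in>UNIV. \<beta> (onb g x i) (onb g x i))"

definition vec_norm_sq :: "'n::finite local_metric \<Rightarrow> real^'n \<Rightarrow> real^'n \<Rightarrow> real" where
  "vec_norm_sq g x v = g x v v"

definition tensor_norm_sq ::
  "'n::finite local_metric \<Rightarrow> (real^'n \<Rightarrow> real^'n \<Rightarrow> real^'n) \<Rightarrow> real^'n \<Rightarrow> real" where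
  "tensor_norm_sq g T x = (\<Sum>i\<in>UNIV. vec_norm_sq g x (T x (onb g x i)))"

definition nabla_tensor_norm_sq ::
  "'n::finite local_metric \<Rightarrow> (real^'n \<Rightarrow> real^'n \<Rightarrow> real^'n) \<Rightarrow> real^'n \<Rightarrow> real" where
  "nabla_tensor_norm_sq g T x =
     (\<Sum>i\<in>UNIV. \<Sum>j\<in>UNIV. vec_norm_sq g x (nabla_tensor g (onb g x i) T x (onb g x j)))"

definition grad :: "'n::finite local_metric \<Rightarrow> (real^'n \<Rightarrow> real) \<Rightarrow> real^'n \<Rightarrow> real^'n" where
  "grad g f x = sharp g x (frechet_derivative f (at x))"

definition divergence :: "'n::finite local_metric \<Rightarrow> (real^'n \<Rightarrow> real^'n) \<Rightarrow> real^'n \<Rightarrow> real" where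
  "divergence g X x = metric_trace g x (\<lambda>u v. g x (nabla g u X x) v)"

definition tensor_divergence ::
  "'n::finite local_metric \<Rightarrow> (real^'n \<Rightarrow> real^'n \<Rightarrow> real^'n) \<Rightarrow> real^'n \<Rightarrow> real^'n" where
  "tensor_divergence g T x = metric_trace g x (\<lambda>u v. nabla_tensor g u T x v)"

definition laplacian :: "'n::finite local_metric \<Rightarrow> (real^'n \<Rightarrow> real) \<Rightarrow> real^'n \<Rightarrow> real" where
  "laplacian g f x = - divergence g (grad g f) x"

definition curvature ::
  "'n::finite local_metric \<Rightarrow> real^'n \<Rightarrow> real^'n \<Rightarrow> real^'n \<Rightarrow> real^'n \<Rightarrow> real^'n" where
  "curvature g x u v w =
     nabla g u (nabla g v (\<lambda>_. w)) x - nabla g v (nabla g u (\<lambda>_. w)) x"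

definition sectional_curvature :: "'n::finite local_metric \<Rightarrow> real^'n \<Rightarrow> real^'n \<Rightarrow> real^'n \<Rightarrow> real" where
  "sectional_curvature g x u v =
     g x (curvature g x u v v) u / (g x u u * g x v v - (g x u v)\<^sup>2)"

definition gauss_curvature :: "2 local_metric \<Rightarrow> real^2 \<Rightarrow> real" where
  "gauss_curvature g x = sectional_curvature g x (axis 1 1) (axis 2 1)"


section \<open>Extrinsic geometry of a surface in a pair of charts\<close>

text \<open>\<open>f\<close> is the coordinate expression of the immersion, \<open>g\<close> the metric of the surface and
  \<open>h\<close> that of the ambient manifold.\<close>

definition nabla_along ::
  "'b::finite local_metric \<Rightarrow> (real^'a::finite \<Rightarrow> real^'b) \<Rightarrow> real^'a \<Rightarrow> (real^'a \<Rightarrow> real^'b) \<Rightarrow>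
   real^'a \<Rightarrow> real^'b" where
  "nabla_along h f u W x =
     frechet_derivative W (at x) u + christoffel h (f x) (frechet_derivative f (at x) u) (W x)"

text \<open>Gauss formula: \<open>\<nabla>\<^sub>u (df V) = df (\<nabla>\<^sub>u V) + B u v\<close>, with the connection of the pullback bundle
  on the left.\<close>
definition second_fundamental_form ::
  "'a::finite local_metric \<Rightarrow> 'b::finite local_metric \<Rightarrow> (real^'a \<Rightarrow> real^'b) \<Rightarrow>
   real^'a \<Rightarrow> real^'a \<Rightarrow> real^'a \<Rightarrow> real^'b" where
  "second_fundamental_form g h f x u v =
     nabla_along h f u (\<lambda>y. frechet_derivative f (at y) v) x
     - frechet_derivative f (at x) (nabla g u (\<lambda>_. v) x)"

definition mean_curvature ::
  "2 local_metric \<Rightarrow> 'b::finite local_metric \<Rightarrow> (real^2 \<Rightarrow> real^'b) \<Rightarrow> real^2 \<Rightarrow> real^'b" where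
  "mean_curvature g h f x = (1 / 2) *\<^sub>R metric_trace g x (second_fundamental_form g h f x)"

definition tension_field ::
  "2 local_metric \<Rightarrow> 'b::finite local_metric \<Rightarrow> (real^2 \<Rightarrow> real^'b) \<Rightarrow> real^2 \<Rightarrow> real^'b" where
  "tension_field g h f x = 2 *\<^sub>R mean_curvature g h f x"

definition shape_operator_H ::
  "2 local_metric \<Rightarrow> 'b::finite local_metric \<Rightarrow> (real^2 \<Rightarrow> real^'b) \<Rightarrow> real^2 \<Rightarrow> real^2 \<Rightarrow> real^2" where
  "shape_operator_H g h f x u =
     sharp g x (\<lambda>v. h (f x) (second_fundamental_form g h f x u v) (mean_curvature g h f x))"

definition stress_bienergy ::
  "2 local_metric \<Rightarrow> 'b::finite local_metric \<Rightarrow> (real^2 \<Rightarrow> real^'b) \<Rightarrow> real^2 \<Rightarrow> real^2 \<Rightarrow> real^2" where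
  "stress_bienergy g h f x u =
     (- 2 * vec_norm_sq h (f x) (mean_curvature g h f x)) *\<^sub>R u + 4 *\<^sub>R shape_operator_H g h f x u"

definition tension_norm_sq ::
  "2 local_metric \<Rightarrow> 'b::finite local_metric \<Rightarrow> (real^2 \<Rightarrow> real^'b) \<Rightarrow> real^2 \<Rightarrow> real" where
  "tension_norm_sq g h f x = vec_norm_sq h (f x) (tension_field g h f x)"

definition biconservative ::
  "('m, 2, 'y) riemannian_scheme \<Rightarrow> ('p, 'b::finite, 'z) riemannian_scheme \<Rightarrow> ('m \<Rightarrow> 'p) \<Rightarrow> bool" where
  "biconservative M N \<phi> \<longleftrightarrow>
     (\<forall>c\<in>atlas M. \<forall>d\<in>atlas N. \<forall>x\<in>local_dom \<phi> c d.
        let g = local_metric M c; h = local_metric N d; f = local_map \<phi> c d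
        in tensor_divergence g (stress_bienergy g h f) x = 0)"

end

theory Submission
  imports Defs
begin

text \<open>
  Four properties of the stress-bienergy tensor carry the formula: it is a smooth \<open>(1,1)\<close>-tensor field on
  the surface, self-adjoint because the second fundamental form is symmetric, of trace
  \<open>-4|H|\<^sup>2 + 8|H|\<^sup>2 = |\<tau>(\<phi>)|\<^sup>2\<close>, and divergence free by hypothesis. The formula then holds for every
  divergence-free self-adjoint tensor field \<open>S\<close> on a surface, with \<open>t\<close> its trace in the place of
  \<open>|\<tau>(\<phi>)|\<^sup>2\<close> (lemma \<open>bochner_divergence_free\<close>). The invariant reason is the following. In dimension two
  the divergence and the trace of a self-adjoint \<open>S\<close> determine the skew part of \<open>\<nabla>S\<close>: if \<open>div S = 0\<close>,
  then \<open>(\<nabla>\<^sub>X S) Y - (\<nabla>\<^sub>Y S) X = (X t) Y - (Y t) X\<close>. Commuting covariant derivatives in the rough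
  Laplacian of \<open>S\<close> therefore gives
  \<open>trace \<nabla>\<^sup>2 S = K (2 S - t I) + (trace \<nabla>\<^sup>2 t) I - \<nabla>\<^sup>2 t\<close>. Pairing with \<open>S\<close> and using
  \<open>\<langle>\<nabla>\<^sup>2 t, S\<rangle> = div (S (grad t))\<close>, again from \<open>div S = 0\<close>, yields the formula.

  The computation is carried out in a smooth orthonormal frame \<open>E\<^sub>1, E\<^sub>2\<close> over a chart. There the
  Levi-Civita connection is one 1-form \<open>\<omega>\<close> with \<open>\<nabla>E\<^sub>1 = \<omega> E\<^sub>2\<close>, and everything becomes scalar: \<open>S\<close> is
  three functions \<open>a, b, c\<close>, the frame acts by two derivations whose commutator is
  \<open>-\<omega>(E\<^sub>1) E\<^sub>1 - \<omega>(E\<^sub>2) E\<^sub>2\<close> (\<open>D_commutator\<close>), and the curvature is \<open>K = -d\<omega>(E\<^sub>1, E\<^sub>2)\<close>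
  (\<open>gauss_curvature_frame\<close>). The vanishing divergence is two first-order equations for \<open>a, b, c\<close>; with
  their derivatives along the frame, the claim is a polynomial identity.

  The remaining work is regularity: all the fields, above all the mean curvature field, which involves
  the inverse of the ambient metric, have to be shown smooth before they can be differentiated.
\<close>

section \<open>Calculus of smooth functions\<close>

lemma differentiable_upto_subset:
  "differentiable_upto k S f \<Longrightarrow> T \<subseteq> S \<Longrightarrow> differentiable_upto k T f"
  by (induction k arbitrary: f) (auto intro: continuous_on_subset)

lemma differentiable_upto_SucD:
  "differentiable_upto (Suc k) S f \<Longrightarrow> differentiable_upto k S f"
proof (induction k arbitrary: f)
  case 0
  then show ?case
    by (auto intro!: continuous_at_imp_continuous_on differentiable_imp_continuous_within)
next
  case (Suc k)
  then show ?case by (metis differentiable_upto.simps(2))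
qed

lemma differentiable_uptoD:
  assumes "differentiable_upto (Suc k) S f"
  shows "x \<in> S \<Longrightarrow> (f has_derivative frechet_derivative f (at x)) (at x)"
    and "differentiable_upto k S (\<lambda>x. frechet_derivative f (at x) v)"
    and "differentiable_upto k S f"
  using assms differentiable_upto_SucD[OF assms] by (auto simp: frechet_derivative_works)

lemma differentiable_upto_cong:
  assumes "open S" "\<And>x. x \<in> S \<Longrightarrow> f x = g x" "differentiable_upto k S f"
  shows "differentiable_upto k S g"
  using assms(2,3)
proof (induction k arbitrary: f g)
  case 0
  then show ?case using continuous_on_cong[of S S f g] by simp
next
  case (Suc k)
  have d: "(g has_derivative frechet_derivative f (at x)) (at x)" if "x \<in> S" for x
    using has_derivative_transform_within_open[OF differentiable_uptoD(1)[OF Suc.prems(2) that] assms(1) that]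
      Suc.prems(1) by blast
  have e: "frechet_derivative f (at x) v = frechet_derivative g (at x) v" if "x \<in> S" for x v
    using frechet_derivative_at[OF d[OF that]] by simp
  have "differentiable_upto k S (\<lambda>x. frechet_derivative g (at x) v)" for v
    by (rule Suc.IH[OF _ differentiable_uptoD(2)[OF Suc.prems(2)]]) (rule e)
  with d show ?case by (auto simp: differentiable_def)
qed

text \<open>The derivative may be given by any formula on an open set; this is the step of every induction on
  the order of differentiability below.\<close>
lemma differentiable_upto_SucI:
  assumes "open S" "\<And>x. x \<in> S \<Longrightarrow> (f has_derivative D x) (at x)"
    "\<And>v. differentiable_upto k S (\<lambda>x. D x v)"
  shows "differentiable_upto (Suc k) S f"
proof -
  have e: "D x v = frechet_derivative f (at x) v" if "x \<in> S" for x v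
    using frechet_derivative_at[OF assms(2)[OF that]] by simp
  have "differentiable_upto k S (\<lambda>x. frechet_derivative f (at x) v)" for v
    by (rule differentiable_upto_cong[OF assms(1) _ assms(3)[of v]]) (rule e)
  with assms(2) show ?thesis by (auto simp: differentiable_def)
qed

lemma differentiable_upto_const: "differentiable_upto k S (\<lambda>x. c)"
  by (induction k arbitrary: c) auto

lemma differentiable_upto_linear:
  assumes "open S" "bounded_linear L" "differentiable_upto k S f"
  shows "differentiable_upto k S (\<lambda>x. L (f x))"
  using assms(3)
proof (induction k arbitrary: f)
  case 0
  then show ?case using bounded_linear.continuous_on[OF assms(2)] by simp
next
  case (Suc k)
  note f = differentiable_uptoD[OF Suc.prems]
  show ?case
    by (rule differentiable_upto_SucI[OF assms(1) bounded_linear.has_derivative[OF assms(2) f(1)]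
          Suc.IH[OF f(2)]])
qed

lemma differentiable_upto_add:
  assumes "open S" "differentiable_upto k S f" "differentiable_upto k S g"
  shows "differentiable_upto k S (\<lambda>x. f x + g x)"
  using assms(2,3)
proof (induction k arbitrary: f g)
  case 0
  then show ?case by (auto intro: continuous_on_add)
next
  case (Suc k)
  note f = differentiable_uptoD[OF Suc.prems(1)] and g = differentiable_uptoD[OF Suc.prems(2)]
  show ?case
    by (rule differentiable_upto_SucI[OF assms(1) has_derivative_add[OF f(1) g(1)]
          Suc.IH[OF f(2) g(2)]])
qed

lemma differentiable_upto_bilinear:
  assumes "open S" "bounded_bilinear B" "differentiable_upto k S f" "differentiable_upto k S g"
  shows "differentiable_upto k S (\<lambda>x. B (f x) (g x))"
  using assms(3,4)
proof (induction k arbitrary: f g)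
  case 0
  then show ?case using bounded_bilinear.continuous_on[OF assms(2)] by simp
next
  case (Suc k)
  note f = differentiable_uptoD[OF Suc.prems(1)] and g = differentiable_uptoD[OF Suc.prems(2)]
  show ?case
    by (rule differentiable_upto_SucI[OF assms(1) bounded_bilinear.FDERIV[OF assms(2) f(1) g(1)]
          differentiable_upto_add[OF assms(1) Suc.IH[OF f(3) g(2)] Suc.IH[OF f(2) g(3)]]])
qed

lemma differentiable_upto_sum:
  assumes "open S" "\<And>i. i \<in> I \<Longrightarrow> differentiable_upto k S (f i)"
  shows "differentiable_upto k S (\<lambda>x. \<Sum>i\<in>I. f i x)"
  using assms(2)
proof (induction I rule: infinite_finite_induct)
  case (insert i I)
  then have "differentiable_upto k S (\<lambda>x. f i x + (\<Sum>i\<in>I. f i x))"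
    by (intro differentiable_upto_add[OF assms(1)]) auto
  with insert show ?case by simp
qed (simp_all add: differentiable_upto_const)

lemma linear_euclidean_sum:
  fixes L :: "'a::euclidean_space \<Rightarrow> 'b::real_vector"
  assumes "linear L"
  shows "L v = (\<Sum>b\<in>Basis. (v \<bullet> b) *\<^sub>R L b)"
proof -
  have "L v = L (\<Sum>b\<in>Basis. (v \<bullet> b) *\<^sub>R b)" by (simp only: euclidean_representation)
  also have "\<dots> = (\<Sum>b\<in>Basis. (v \<bullet> b) *\<^sub>R L b)"
    by (simp only: linear_sum[OF assms] linear_cmul[OF assms])
  finally show ?thesis .
qed

text \<open>Expanding the chain rule over a basis turns the derivative of the composition into a sum of
  products of functions that the induction hypothesis covers: the derivatives of the outer function
  along fixed basis vectors are composed with \<open>f\<close>, and only the coefficients vary.\<close>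
lemma differentiable_upto_compose:
  fixes f :: "'a::real_normed_vector \<Rightarrow> 'b::euclidean_space" and h :: "'b \<Rightarrow> 'c::real_normed_vector"
  assumes "open S" "f ` S \<subseteq> T" "differentiable_upto k S f" "differentiable_upto k T h"
  shows "differentiable_upto k S (\<lambda>x. h (f x))"
  using assms(3,4)
proof (induction k arbitrary: h)
  case 0
  then show ?case using continuous_on_compose2[of T h S f] assms(2) by simp
next
  case (Suc k)
  note f = differentiable_uptoD[OF Suc.prems(1)] and h = differentiable_uptoD[OF Suc.prems(2)]
  have fT: "f x \<in> T" if "x \<in> S" for x using that assms(2) by blast
  let ?D = "\<lambda>x v. \<Sum>b\<in>Basis. (frechet_derivative f (at x) v \<bullet> b) *\<^sub>R frechet_derivative h (at (f x)) b"
  show ?case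
  proof (rule differentiable_upto_SucI[OF assms(1), of _ ?D])
    fix x assume x: "x \<in> S"
    have "?D x = (\<lambda>v. frechet_derivative h (at (f x)) (frechet_derivative f (at x) v))"
      by (rule ext, rule linear_euclidean_sum[symmetric], rule has_derivative_linear[OF h(1)[OF fT[OF x]]])
    then show "((\<lambda>x. h (f x)) has_derivative ?D x) (at x)"
      using has_derivative_compose[OF f(1)[OF x] h(1)[OF fT[OF x]]] by simp
  next
    fix v
    show "differentiable_upto k S (\<lambda>x. ?D x v)"
      by (intro differentiable_upto_sum differentiable_upto_bilinear[OF _ bounded_bilinear_scaleR]
          differentiable_upto_linear[OF _ bounded_linear_inner_left] assms(1) f(2) Suc.IH f(3) h(2))
  qed
qed

text \<open>Real powers are closed under differentiation up to constants, so one induction covers both the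
  reciprocals and the square roots that are used for inverse matrices and normalisation.\<close>
lemma differentiable_upto_powr:
  fixes p :: real
  shows "differentiable_upto k {0<..} (\<lambda>x. x powr p)"
proof (induction k arbitrary: p)
  case 0
  show ?case by (auto intro!: continuous_intros)
next
  case (Suc k)
  show ?case
  proof (rule differentiable_upto_SucI)
    fix x :: real assume "x \<in> {0<..}"
    then have "((\<lambda>x. x powr p) has_derivative (*) (p * x powr (p - 1))) (at x)"
      using has_real_derivative_powr[of x p] by (simp add: has_field_derivative_def)
    moreover have "(*) (p * x powr (p - 1)) = (\<lambda>v. v * (p * x powr (p - 1)))"
      by (rule ext) (rule mult.commute)
    ultimately show "((\<lambda>x. x powr p) has_derivative (\<lambda>v. v * (p * x powr (p - 1)))) (at x)"
      by (simp only:)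
  next
    fix v
    show "differentiable_upto k {0<..} (\<lambda>x. v * (p * x powr (p - 1)))"
      by (intro differentiable_upto_linear[OF _ bounded_linear_mult_right] Suc.IH) auto
  qed simp
qed

lemma smooth_on_subset: "smooth_on S f \<Longrightarrow> T \<subseteq> S \<Longrightarrow> smooth_on T f"
  by (auto simp: smooth_on_def intro: differentiable_upto_subset)

lemma smooth_on_cong:
  "open S \<Longrightarrow> (\<And>x. x \<in> S \<Longrightarrow> f x = g x) \<Longrightarrow> smooth_on S f \<Longrightarrow> smooth_on S g"
  unfolding smooth_on_def using differentiable_upto_cong by blast

lemma smooth_on_const: "smooth_on S (\<lambda>x. c)"
  by (simp add: smooth_on_def differentiable_upto_const)

lemma smooth_on_ident: "open S \<Longrightarrow> smooth_on S (\<lambda>x. x)"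
  unfolding smooth_on_def
proof
  show "open S \<Longrightarrow> differentiable_upto k S (\<lambda>x. x)" for k
    by (cases k) (auto intro: differentiable_upto_const)
qed

lemma smooth_on_linear:
  "open S \<Longrightarrow> bounded_linear L \<Longrightarrow> smooth_on S f \<Longrightarrow> smooth_on S (\<lambda>x. L (f x))"
  by (simp add: smooth_on_def differentiable_upto_linear)

lemma smooth_on_add:
  "open S \<Longrightarrow> smooth_on S f \<Longrightarrow> smooth_on S g \<Longrightarrow> smooth_on S (\<lambda>x. f x + g x)"
  by (simp add: smooth_on_def differentiable_upto_add)

lemma smooth_on_bilinear:
  "open S \<Longrightarrow> bounded_bilinear B \<Longrightarrow> smooth_on S f \<Longrightarrow> smooth_on S g \<Longrightarrow> smooth_on S (\<lambda>x. B (f x) (g x))"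
  by (simp add: smooth_on_def differentiable_upto_bilinear)

lemmas smooth_on_mult = smooth_on_bilinear[OF _ bounded_bilinear_mult]
lemmas smooth_on_scaleR = smooth_on_bilinear[OF _ bounded_bilinear_scaleR]
lemmas smooth_on_component = smooth_on_linear[OF _ bounded_linear_vec_nth]

lemma smooth_on_sum:
  "open S \<Longrightarrow> (\<And>i. i \<in> I \<Longrightarrow> smooth_on S (f i)) \<Longrightarrow> smooth_on S (\<lambda>x. \<Sum>i\<in>I. f i x)"
  by (simp add: smooth_on_def differentiable_upto_sum)

lemma smooth_on_prod:
  fixes f :: "'i \<Rightarrow> 'a::real_normed_vector \<Rightarrow> real"
  assumes "open S" "\<And>i. i \<in> I \<Longrightarrow> smooth_on S (f i)"
  shows "smooth_on S (\<lambda>x. \<Prod>i\<in>I. f i x)"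
  using assms(2)
proof (induction I rule: infinite_finite_induct)
  case (insert i I)
  then have "smooth_on S (\<lambda>x. f i x * (\<Prod>i\<in>I. f i x))"
    by (intro smooth_on_mult[OF assms(1)]) auto
  with insert show ?case by simp
qed (simp_all add: smooth_on_const)

lemma smooth_on_minus: "open S \<Longrightarrow> smooth_on S f \<Longrightarrow> smooth_on S (\<lambda>x. - f x)"
  by (rule smooth_on_linear[OF _ bounded_linear_minus[OF bounded_linear_ident]])

lemma smooth_on_diff:
  "open S \<Longrightarrow> smooth_on S f \<Longrightarrow> smooth_on S g \<Longrightarrow> smooth_on S (\<lambda>x. f x - g x)"
  using smooth_on_add[of S f "\<lambda>x. - g x"] by (simp add: smooth_on_minus)

lemma smooth_on_compose:
  fixes f :: "'a::real_normed_vector \<Rightarrow> 'b::euclidean_space"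
  shows "open S \<Longrightarrow> f ` S \<subseteq> T \<Longrightarrow> smooth_on S f \<Longrightarrow> smooth_on T h \<Longrightarrow> smooth_on S (\<lambda>x. h (f x))"
  unfolding smooth_on_def using differentiable_upto_compose by blast

lemma smooth_on_powr:
  fixes f :: "'a::real_normed_vector \<Rightarrow> real"
  assumes "open S" "smooth_on S f" "\<And>x. x \<in> S \<Longrightarrow> 0 < f x"
  shows "smooth_on S (\<lambda>x. f x powr p)"
proof (rule smooth_on_compose[OF assms(1) _ assms(2)])
  show "f ` S \<subseteq> {0<..}" using assms(3) by auto
  show "smooth_on {0<..} (\<lambda>x. x powr p)" unfolding smooth_on_def using differentiable_upto_powr by blast
qed

lemma smooth_on_divide:
  fixes f g :: "'a::real_normed_vector \<Rightarrow> real"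
  assumes "open S" "smooth_on S f" "smooth_on S g" "\<And>x. x \<in> S \<Longrightarrow> g x \<noteq> 0"
  shows "smooth_on S (\<lambda>x. f x / g x)"
proof -
  \<comment> \<open>Squaring \<open>g\<close> reduces a denominator of unknown sign to a power of a positive function.\<close>
  have pos: "0 < g x * g x" if "x \<in> S" for x
    using assms(4)[OF that] by (metis mult_neg_neg mult_pos_pos linorder_neqE_linordered_idom)
  have "smooth_on S (\<lambda>x. f x * (g x * (g x * g x) powr (-1)))"
    using assms pos by (intro smooth_on_mult smooth_on_powr) auto
  then show ?thesis
    by (rule smooth_on_cong[OF assms(1), rotated]) (use pos assms(4) in \<open>auto simp: powr_minus field_simps\<close>)
qed

lemma smooth_on_vec:
  fixes f :: "'a::real_normed_vector \<Rightarrow> real^'n"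
  assumes "open S" "\<And>i. smooth_on S (\<lambda>x. f x $ i)"
  shows "smooth_on S f"
proof -
  have "smooth_on S (\<lambda>x. (\<Sum>i\<in>UNIV. (f x $ i) *\<^sub>R axis i 1) :: real^'n)"
    using assms by (intro smooth_on_sum smooth_on_scaleR smooth_on_const) auto
  moreover have "(\<lambda>x. \<Sum>i\<in>UNIV. (f x $ i) *\<^sub>R axis i 1) = f"
  proof
    show "(\<Sum>i\<in>UNIV. (f x $ i) *\<^sub>R axis i 1) = f x" for x
      using basis_expansion[of "f x"] by (simp add: scalar_mult_eq_scaleR)
  qed
  ultimately show ?thesis by (simp only:)
qed

lemma smooth_on_imp_differentiable: "smooth_on S f \<Longrightarrow> x \<in> S \<Longrightarrow> f differentiable (at x)"
  unfolding smooth_on_def using differentiable_upto.simps(2) by blast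

lemma smooth_on_derivative: "smooth_on S f \<Longrightarrow> smooth_on S (\<lambda>x. frechet_derivative f (at x) v)"
  unfolding smooth_on_def using differentiable_upto.simps(2) by blast

lemma smooth_on_imp_continuous_on: "smooth_on S f \<Longrightarrow> continuous_on S f"
  unfolding smooth_on_def using differentiable_upto.simps(1) by blast

text \<open>A field of linear maps is smooth as soon as its values on fixed vectors are. All the tensor fields
  on a chart are given in this form.\<close>
lemma smooth_on_linear_family:
  fixes L :: "'a::real_normed_vector \<Rightarrow> 'b::euclidean_space \<Rightarrow> 'c::real_normed_vector"
  assumes "open S" "\<And>x. x \<in> S \<Longrightarrow> linear (L x)" "\<And>v. smooth_on S (\<lambda>x. L x v)" "smooth_on S V"
  shows "smooth_on S (\<lambda>x. L x (V x))"
proof (rule smooth_on_cong[OF assms(1)])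
  show "smooth_on S (\<lambda>x. \<Sum>b\<in>Basis. (V x \<bullet> b) *\<^sub>R L x b)"
    using assms by (intro smooth_on_sum smooth_on_scaleR smooth_on_linear[OF _ bounded_linear_inner_left])
  show "\<And>x. x \<in> S \<Longrightarrow> (\<Sum>b\<in>Basis. (V x \<bullet> b) *\<^sub>R L x b) = L x (V x)"
    using assms(2) linear_euclidean_sum by metis
qed

lemma smooth_on_derivative_along:
  fixes f :: "'a::euclidean_space \<Rightarrow> 'b::real_normed_vector"
  assumes "open S" "smooth_on S f" "smooth_on S V"
  shows "smooth_on S (\<lambda>x. frechet_derivative f (at x) (V x))"
  by (rule smooth_on_linear_family[OF assms(1)])
    (use assms in \<open>auto intro: linear_frechet_derivative smooth_on_derivative smooth_on_imp_differentiable\<close>)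

text \<open>Schwarz's theorem. It makes the second fundamental form symmetric, and it reduces the commutator of
  the frame derivations to the Lie bracket of the frame.\<close>
lemma second_derivative_symmetric:
  fixes f :: "'a::real_normed_vector \<Rightarrow> real"
  assumes "open S" "smooth_on S f" "x \<in> S"
  shows "frechet_derivative (\<lambda>y. frechet_derivative f (at y) u) (at x) v
       = frechet_derivative (\<lambda>y. frechet_derivative f (at y) v) (at x) u"
proof -
  define D where "D u v y = frechet_derivative (\<lambda>y. frechet_derivative f (at y) u) (at y) v" for u v y
  have line: "((\<lambda>t. F (p + t *\<^sub>R w)) has_real_derivative frechet_derivative F (at (p + t *\<^sub>R w)) w) (at t)"
    if "smooth_on S F" "p + t *\<^sub>R w \<in> S" for F :: "'a \<Rightarrow> real" and p w t
  proof -
    have F: "(F has_derivative frechet_derivative F (at (p + t *\<^sub>R w))) (at (p + t *\<^sub>R w))"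
      using smooth_on_imp_differentiable[OF that] frechet_derivative_works by blast
    have "((\<lambda>t. p + t *\<^sub>R w) has_derivative (\<lambda>t. t *\<^sub>R w)) (at t)"
      by (auto intro!: derivative_eq_intros)
    from has_derivative_compose[OF this F]
    have "((\<lambda>t. F (p + t *\<^sub>R w)) has_derivative (\<lambda>s. frechet_derivative F (at (p + t *\<^sub>R w)) (s *\<^sub>R w))) (at t)" .
    moreover have "frechet_derivative F (at (p + t *\<^sub>R w)) (s *\<^sub>R w)
        = frechet_derivative F (at (p + t *\<^sub>R w)) w * s" for s
      using linear_frechet_derivative[OF smooth_on_imp_differentiable[OF that]] by (simp add: linear_cmul)
    ultimately show ?thesis by (simp add: has_field_derivative_def)
  qed
  obtain r where r: "0 < r" "ball x r \<subseteq> S" using assms openE by blast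
  \<comment> \<open>Two applications of the mean value theorem write the second difference of \<open>f\<close> over a small
    parallelogram as \<open>h\<^sup>2\<close> times a mixed derivative; the second difference is symmetric in the two
    directions.\<close>
  have mean: "\<exists>p. dist x p \<le> h * (norm u + norm v) \<and>
      f (x + h *\<^sub>R u + h *\<^sub>R v) - f (x + h *\<^sub>R u) - f (x + h *\<^sub>R v) + f x = h * (h * D u v p)"
    if h: "0 < h" "h * (norm u + norm v) < r" for h u v
  proof -
    have inS: "x + s *\<^sub>R u + t *\<^sub>R v \<in> S" and near: "dist x (x + s *\<^sub>R u + t *\<^sub>R v) \<le> h * (norm u + norm v)"
      if "0 \<le> s" "s \<le> h" "0 \<le> t" "t \<le> h" for s t
    proof -
      have "norm (s *\<^sub>R u + t *\<^sub>R v) \<le> s * norm u + t * norm v"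
        using norm_triangle_ineq[of "s *\<^sub>R u" "t *\<^sub>R v"] that by simp
      also have "\<dots> \<le> h * (norm u + norm v)"
        using that by (simp add: distrib_left add_mono mult_right_mono)
      finally show "dist x (x + s *\<^sub>R u + t *\<^sub>R v) \<le> h * (norm u + norm v)"
        using norm_minus_cancel[of "s *\<^sub>R u + t *\<^sub>R v"] by (simp add: dist_norm)
      then show "x + s *\<^sub>R u + t *\<^sub>R v \<in> S"
        using h r by auto
    qed
    have du: "smooth_on S (\<lambda>y. frechet_derivative f (at y) u)"
      by (rule smooth_on_derivative[OF assms(2)])
    have d1: "((\<lambda>s. f (x + h *\<^sub>R v + s *\<^sub>R u) - f (x + s *\<^sub>R u)) has_real_derivative
        frechet_derivative f (at (x + h *\<^sub>R v + s *\<^sub>R u)) u - frechet_derivative f (at (x + s *\<^sub>R u)) u) (at s)"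
      if "0 \<le> s" "s \<le> h" for s
      using inS[OF that, of h] inS[OF that, of 0] h
      by (intro DERIV_diff line assms) (auto simp: algebra_simps)
    obtain s where s: "0 < s" "s < h"
      "f (x + h *\<^sub>R v + h *\<^sub>R u) - f (x + h *\<^sub>R u) - (f (x + h *\<^sub>R v) - f x)
        = h * (frechet_derivative f (at (x + h *\<^sub>R v + s *\<^sub>R u)) u - frechet_derivative f (at (x + s *\<^sub>R u)) u)"
      using MVT2[OF h(1) d1] by auto
    have d2: "((\<lambda>t. frechet_derivative f (at (x + s *\<^sub>R u + t *\<^sub>R v)) u) has_real_derivative
        D u v (x + s *\<^sub>R u + t *\<^sub>R v)) (at t)"
      if "0 \<le> t" "t \<le> h" for t
      unfolding D_def using inS[of s t] that s by (intro line[OF du]) auto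
    obtain t where t: "0 < t" "t < h"
      "frechet_derivative f (at (x + s *\<^sub>R u + h *\<^sub>R v)) u - frechet_derivative f (at (x + s *\<^sub>R u)) u
        = h * D u v (x + s *\<^sub>R u + t *\<^sub>R v)"
      using MVT2[OF h(1) d2] by auto
    show ?thesis
      using near[of s t] s t by (intro exI[of _ "x + s *\<^sub>R u + t *\<^sub>R v"]) (auto simp: algebra_simps)
  qed
  have cont: "isCont (D u v) x" for u v
    using smooth_on_imp_continuous_on[OF smooth_on_derivative[OF smooth_on_derivative[OF assms(2)]]]
      assms(1,3) unfolding D_def by (simp add: continuous_on_eq_continuous_at)
  have "D u v x = D v u x"
  proof (rule ccontr)
    assume "D u v x \<noteq> D v u x"
    then have e: "0 < \<bar>D u v x - D v u x\<bar> / 2" (is "0 < ?e") by simp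
    obtain d1 where d1: "0 < d1" "\<And>p. dist p x < d1 \<Longrightarrow> dist (D u v p) (D u v x) < ?e"
      using cont[of u v] e unfolding continuous_at_eps_delta dist_norm by blast
    obtain d2 where d2: "0 < d2" "\<And>p. dist p x < d2 \<Longrightarrow> dist (D v u p) (D v u x) < ?e"
      using cont[of v u] e unfolding continuous_at_eps_delta dist_norm by blast
    define m where "m = min r (min d1 d2)"
    define l where "l = norm u + norm v + 1"
    define h where "h = (m / 2) / l"
    have n: "0 \<le> norm u + norm v" by simp
    have m: "0 < m" using r d1 d2 by (simp add: m_def)
    have "0 < norm u + norm v + 1" using n by linarith
    then have l: "0 < l" by (simp add: l_def)
    then have h: "0 < h" and hl: "h * l = m / 2"
      unfolding h_def using m by simp_all
    have "h * (norm u + norm v) \<le> h * l" using h by (simp add: l_def)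
    also note hl
    finally have hm: "h * (norm u + norm v) < m" using m by simp
    obtain p where p: "dist x p \<le> h * (norm u + norm v)"
      "f (x + h *\<^sub>R u + h *\<^sub>R v) - f (x + h *\<^sub>R u) - f (x + h *\<^sub>R v) + f x = h * (h * D u v p)"
      using mean[of h u v] h hm m_def by auto
    obtain q where q: "dist x q \<le> h * (norm v + norm u)"
      "f (x + h *\<^sub>R v + h *\<^sub>R u) - f (x + h *\<^sub>R v) - f (x + h *\<^sub>R u) + f x = h * (h * D v u q)"
      using mean[of h v u] h hm m_def by (auto simp: add.commute)
    have "h * (h * D u v p) = h * (h * D v u q)"
      unfolding p(2)[symmetric] q(2)[symmetric] by (simp add: add.assoc add.commute[of "h *\<^sub>R u"])
    then have "D u v p = D v u q" using h by simp
    moreover have "dist p x < d1" "dist q x < d2"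
      using p q hm by (auto simp: m_def dist_commute add.commute)
    ultimately show False
      using d1(2)[of p] d2(2)[of q] by (auto simp: dist_real_def abs_if field_simps split: if_splits)
  qed
  then show ?thesis by (simp add: D_def)
qed

text \<open>The product rule for a field of linear maps applied to a field of vectors, where the derivative
  of the former is known only on fixed vectors.\<close>
lemma has_derivative_linear_family:
  fixes L :: "'a::real_normed_vector \<Rightarrow> 'b::euclidean_space \<Rightarrow> 'c::real_normed_vector"
  assumes "open S" "x \<in> S" "\<And>y. y \<in> S \<Longrightarrow> linear (L y)"
    "\<And>v. ((\<lambda>y. L y v) has_derivative (\<lambda>u. L' u v)) (at x)"
    "(V has_derivative V') (at x)"
  shows "((\<lambda>y. L y (V y)) has_derivative (\<lambda>u. L' u (V x) + L x (V' u))) (at x)"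
proof -
  have d: "((\<lambda>y. L y (W y)) has_derivative
      (\<lambda>u. (\<Sum>b\<in>Basis. (W x \<bullet> b) *\<^sub>R L' u b + (W' u \<bullet> b) *\<^sub>R L x b))) (at x)"
    if "(W has_derivative W') (at x)" for W W'
  proof (rule has_derivative_transform_within_open[OF _ assms(1,2)])
    show "((\<lambda>y. \<Sum>b\<in>Basis. (W y \<bullet> b) *\<^sub>R L y b) has_derivative
        (\<lambda>u. (\<Sum>b\<in>Basis. (W x \<bullet> b) *\<^sub>R L' u b + (W' u \<bullet> b) *\<^sub>R L x b))) (at x)"
      by (intro has_derivative_sum has_derivative_scaleR has_derivative_inner_left assms(4) that)
  qed (rule linear_euclidean_sum[OF assms(3), symmetric])
  \<comment> \<open>The rule for a constant field shows that \<open>L' u\<close> is again linear in the vector.\<close>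
  have "L' u v = (\<Sum>b\<in>Basis. (v \<bullet> b) *\<^sub>R L' u b)" for u v
    using has_derivative_unique[OF assms(4)[of v] d[OF has_derivative_const[of v]]]
    by (metis (no_types, lifting) add.right_neutral inner_zero_left scaleR_zero_left sum.cong)
  moreover have "L x v = (\<Sum>b\<in>Basis. (v \<bullet> b) *\<^sub>R L x b)" for v
    by (rule linear_euclidean_sum[OF assms(3)[OF assms(2)]])
  ultimately have "(\<Sum>b\<in>Basis. (V x \<bullet> b) *\<^sub>R L' u b + (V' u \<bullet> b) *\<^sub>R L x b) = L' u (V x) + L x (V' u)" for u
    by (metis sum.distrib)
  with d[OF assms(5)] show ?thesis by simp
qed

lemma linear_derivative_of_linear_family:
  fixes L :: "'a::real_normed_vector \<Rightarrow> 'b::real_normed_vector \<Rightarrow> 'c::real_normed_vector"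
  assumes "open S" "x \<in> S" "\<And>y. y \<in> S \<Longrightarrow> linear (L y)"
    "\<And>v. (\<lambda>y. L y v) differentiable (at x)"
  shows "linear (\<lambda>v. frechet_derivative (\<lambda>y. L y v) (at x) u)"
proof (rule linearI)
  note D = assms(4)[unfolded frechet_derivative_works]
  fix v w and r :: real
  have "((\<lambda>y. L y (v + w)) has_derivative
      (\<lambda>u. frechet_derivative (\<lambda>y. L y v) (at x) u + frechet_derivative (\<lambda>y. L y w) (at x) u)) (at x)"
    by (rule has_derivative_transform_within_open[OF has_derivative_add[OF D[of v] D[of w]] assms(1,2)])
      (simp add: linear_add assms(3))
  then show "frechet_derivative (\<lambda>y. L y (v + w)) (at x) u
      = frechet_derivative (\<lambda>y. L y v) (at x) u + frechet_derivative (\<lambda>y. L y w) (at x) u"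
    using frechet_derivative_at by metis
  have "((\<lambda>y. L y (r *\<^sub>R v)) has_derivative (\<lambda>u. r *\<^sub>R frechet_derivative (\<lambda>y. L y v) (at x) u)) (at x)"
    by (rule has_derivative_transform_within_open[OF has_derivative_scaleR_right[OF D[of v]] assms(1,2)])
      (simp add: linear_cmul assms(3))
  then show "frechet_derivative (\<lambda>y. L y (r *\<^sub>R v)) (at x) u = r *\<^sub>R frechet_derivative (\<lambda>y. L y v) (at x) u"
    using frechet_derivative_at by metis
qed

lemma linear_axis_sum:
  fixes L :: "real^'n \<Rightarrow> 'b::real_vector"
  assumes "linear L"
  shows "L v = (\<Sum>i\<in>UNIV. (v $ i) *\<^sub>R L (axis i 1))"
proof -
  have "L v = L (\<Sum>i\<in>UNIV. (v $ i) *\<^sub>R axis i 1)"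
    using basis_expansion[of v] by (simp add: scalar_mult_eq_scaleR)
  also have "\<dots> = (\<Sum>i\<in>UNIV. (v $ i) *\<^sub>R L (axis i 1))"
    by (simp only: linear_sum[OF assms] linear_cmul[OF assms])
  finally show ?thesis .
qed

lemma smooth_on_det:
  fixes A :: "'a::real_normed_vector \<Rightarrow> real^'n^'n"
  assumes "open S" "\<And>i j. smooth_on S (\<lambda>x. A x $ i $ j)"
  shows "smooth_on S (\<lambda>x. det (A x))"
  unfolding det_def
  by (intro smooth_on_sum smooth_on_mult smooth_on_prod smooth_on_const assms)

lemma frechet_derivative_add:
  assumes "f differentiable (at x)" "h differentiable (at x)"
  shows "frechet_derivative (\<lambda>y. f y + h y) (at x) u = frechet_derivative f (at x) u + frechet_derivative h (at x) u"
  using frechet_derivative_at[OF has_derivative_add[OF assms[unfolded frechet_derivative_works]]] by (simp add: fun_eq_iff)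

lemma frechet_derivative_diff:
  assumes "f differentiable (at x)" "h differentiable (at x)"
  shows "frechet_derivative (\<lambda>y. f y - h y) (at x) u = frechet_derivative f (at x) u - frechet_derivative h (at x) u"
  using frechet_derivative_at[OF has_derivative_diff[OF assms[unfolded frechet_derivative_works]]] by (simp add: fun_eq_iff)

lemma frechet_derivative_mult:
  fixes f h :: "'a::real_normed_vector \<Rightarrow> real"
  assumes "f differentiable (at x)" "h differentiable (at x)"
  shows "frechet_derivative (\<lambda>y. f y * h y) (at x) u = frechet_derivative f (at x) u * h x + f x * frechet_derivative h (at x) u"
  using fun_cong[OF frechet_derivative_at[OF has_derivative_mult[OF assms[unfolded frechet_derivative_works]]], of u]
  by simp

lemma frechet_derivative_cong:
  assumes "open S" "x \<in> S" "\<And>y. y \<in> S \<Longrightarrow> f y = h y" "f differentiable (at x)"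
  shows "frechet_derivative f (at x) = frechet_derivative h (at x)"
  by (rule frechet_derivative_transform_within_open[OF assms(4,1,2,3)])

section \<open>The Levi-Civita connection of a metric in a chart\<close>

text \<open>A Riemannian metric in coordinates, of any dimension: it serves for the surface and for the ambient
  manifold.\<close>
locale chart_metric =
  fixes U :: "(real^'n::finite) set" and g :: "'n local_metric"
  assumes open_U: "open U"
    and g_bilinear: "x \<in> U \<Longrightarrow> bilinear (g x)"
    and g_commute: "x \<in> U \<Longrightarrow> g x u v = g x v u"
    and g_positive: "x \<in> U \<Longrightarrow> u \<noteq> 0 \<Longrightarrow> 0 < g x u u"
    and g_smooth: "smooth_on U (\<lambda>x. g x u v)"
begin

lemma g_linear: assumes "x \<in> U" shows "linear (g x u)" "linear (\<lambda>u. g x u v)"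
  using g_bilinear[OF assms] by (auto simp: bilinear_def)

lemmas g_simps = bilinear_ladd[OF g_bilinear] bilinear_radd[OF g_bilinear]
  bilinear_lmul[OF g_bilinear] bilinear_rmul[OF g_bilinear] bilinear_lneg[OF g_bilinear]
  bilinear_rneg[OF g_bilinear] bilinear_lsub[OF g_bilinear] bilinear_rsub[OF g_bilinear]
  bilinear_lzero[OF g_bilinear] bilinear_rzero[OF g_bilinear]

lemma g_cancel:
  assumes "x \<in> U" "\<And>w. g x y w = g x z w" shows "y = z"
proof (rule ccontr)
  assume "y \<noteq> z"
  then have "0 < g x (y - z) (y - z)" using g_positive[OF assms(1)] by simp
  then show False using assms(2)[of "y - z"] by (simp add: g_simps[OF assms(1)])
qed

lemma sharp_eqI: assumes "x \<in> U" "\<And>w. g x z w = \<omega> w" shows "sharp g x \<omega> = z"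
  unfolding sharp_def using assms g_cancel[OF assms(1)] by (intro the_equality) auto

text \<open>Cramer's rule makes the dual vector a rational function of the metric coefficients, which is
  why it depends smoothly on the point.\<close>

lemma sharp_cramer:
  assumes x: "x \<in> U" and "linear \<omega>"
  defines "A \<equiv> (\<chi> i j. g x (axis j 1) (axis i 1)) :: real^'n^'n"
  shows "det A \<noteq> 0"
    and "g x (sharp g x \<omega>) w = \<omega> w"
    and "sharp g x \<omega> = (\<chi> k. det (\<chi> i j. if j = k then \<omega> (axis i 1) else A $ i $ j) / det A)"
proof -
  have A: "(A *v z) $ i = g x z (axis i 1)" for z i
    using linear_axis_sum[OF g_linear(2)[OF x], of z "axis i 1"]
    by (simp add: A_def matrix_vector_mult_def mult.commute)
  have "z = 0" if "A *v z = 0" for z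
  proof -
    have "g x z (axis i 1) = 0" for i using A[of z i] that by simp
    then have "g x z z = 0" using linear_axis_sum[OF g_linear(1)[OF x], of z z] by simp
    then show "z = 0" using g_positive[OF x, of z] by force
  qed
  then show det: "det A \<noteq> 0"
    using invertible_det_nz[of A] invertible_left_inverse[of A] matrix_left_invertible_ker[of A] by auto
  define z where "z = (\<chi> k. det (\<chi> i j. if j = k then \<omega> (axis i 1) else A $ i $ j) / det A)"
  have "A *v z = (\<chi> i. \<omega> (axis i 1))"
    using cramer[OF det, of z "\<chi> i. \<omega> (axis i 1)"] by (simp add: z_def cong: if_cong)
  then have "g x z (axis i 1) = \<omega> (axis i 1)" for i using A[of z i] by simp
  then have z: "g x z w = \<omega> w" for w
    using linear_axis_sum[OF g_linear(1)[OF x], of z w] linear_axis_sum[OF assms(2), of w] by simp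
  then have "sharp g x \<omega> = z" by (rule sharp_eqI[OF x])
  with z show "g x (sharp g x \<omega>) w = \<omega> w"
    and "sharp g x \<omega> = (\<chi> k. det (\<chi> i j. if j = k then \<omega> (axis i 1) else A $ i $ j) / det A)"
    by (simp_all add: z_def)
qed

lemmas g_sharp = sharp_cramer(2)

lemma smooth_on_sharp:
  assumes "\<And>x. x \<in> U \<Longrightarrow> linear (\<omega> x)" "\<And>w. smooth_on U (\<lambda>x. \<omega> x w)"
  shows "smooth_on U (\<lambda>x. sharp g x (\<omega> x))"
proof (rule smooth_on_vec[OF open_U])
  fix k
  let ?A = "\<lambda>x. (\<chi> i j. g x (axis j 1) (axis i 1)) :: real^'n^'n"
  let ?B = "\<lambda>x. (\<chi> i j. if j = k then \<omega> x (axis i 1) else ?A x $ i $ j) :: real^'n^'n"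
  have "smooth_on U (\<lambda>x. ?B x $ i $ j)" for i j
    by (cases "j = k") (simp_all add: assms(2) g_smooth)
  then have "smooth_on U (\<lambda>x. det (?B x) / det (?A x))"
    using sharp_cramer(1)[OF _ assms(1)]
    by (intro smooth_on_divide smooth_on_det open_U) (simp_all add: g_smooth)
  then show "smooth_on U (\<lambda>x. sharp g x (\<omega> x) $ k)"
    by (rule smooth_on_cong[OF open_U, rotated]) (simp add: sharp_cramer(3)[OF _ assms(1)])
qed

definition dg :: "real^'n \<Rightarrow> real^'n \<Rightarrow> real^'n \<Rightarrow> real^'n \<Rightarrow> real" where
  "dg x u v w = frechet_derivative (\<lambda>y. g y v w) (at x) u"

lemma dg_has_derivative: "x \<in> U \<Longrightarrow> ((\<lambda>y. g y v w) has_derivative (\<lambda>u. dg x u v w)) (at x)"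
  unfolding dg_def using smooth_on_imp_differentiable[OF g_smooth] frechet_derivative_works by blast

lemma dg_linear:
  assumes "x \<in> U"
  shows "linear (\<lambda>u. dg x u v w)" "linear (\<lambda>v. dg x u v w)" "linear (\<lambda>w. dg x u v w)"
proof -
  note d = smooth_on_imp_differentiable[OF g_smooth assms]
  show "linear (\<lambda>u. dg x u v w)" using has_derivative_linear[OF dg_has_derivative[OF assms]] .
  show "linear (\<lambda>v. dg x u v w)" unfolding dg_def
    by (rule linear_derivative_of_linear_family[OF open_U assms g_linear(2) d])
  show "linear (\<lambda>w. dg x u v w)" unfolding dg_def
    by (rule linear_derivative_of_linear_family[OF open_U assms g_linear(1) d])
qed

lemma dg_commute: assumes "x \<in> U" shows "dg x u v w = dg x u w v"
  using frechet_derivative_at[OF has_derivative_transform_within_open[OF dg_has_derivative[OF assms]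
        open_U assms g_commute], of v w]
  unfolding dg_def by metis

text \<open>Linearity in \<open>w\<close> gives the Koszul expression a dual vector, the Christoffel symbol; linearity in
  \<open>u\<close> and \<open>v\<close> then passes to the Christoffel symbol.\<close>
lemma koszul_linear:
  assumes "x \<in> U"
  shows "linear (\<lambda>w. (dg x u v w + dg x v u w - dg x w u v) / 2)"
    "linear (\<lambda>u. (dg x u v w + dg x v u w - dg x w u v) / 2)"
    "linear (\<lambda>v. (dg x u v w + dg x v u w - dg x w u v) / 2)"
proof -
  note L = dg_linear[OF assms]
  show "linear (\<lambda>w. (dg x u v w + dg x v u w - dg x w u v) / 2)"
    "linear (\<lambda>u. (dg x u v w + dg x v u w - dg x w u v) / 2)"
    "linear (\<lambda>v. (dg x u v w + dg x v u w - dg x w u v) / 2)"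
    by (rule linearI; simp add: linear_add[OF L(1)] linear_add[OF L(2)] linear_add[OF L(3)]
        linear_cmul[OF L(1)] linear_cmul[OF L(2)] linear_cmul[OF L(3)] field_simps)+
qed

lemma christoffel_eq_sharp: "christoffel g x u v = sharp g x (\<lambda>w. (dg x u v w + dg x v u w - dg x w u v) / 2)"
  by (simp add: christoffel_def dg_def)

lemma g_christoffel:
  "x \<in> U \<Longrightarrow> g x (christoffel g x u v) w = (dg x u v w + dg x v u w - dg x w u v) / 2"
  unfolding christoffel_eq_sharp by (rule g_sharp[OF _ koszul_linear(1)])

lemma christoffel_commute: assumes "x \<in> U" shows "christoffel g x u v = christoffel g x v u"
  by (rule g_cancel[OF assms])
    (simp add: g_christoffel[OF assms] dg_commute[OF assms, of _ u v] add.commute)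

lemma christoffel_linear:
  assumes "x \<in> U" shows "linear (\<lambda>u. christoffel g x u v)" "linear (christoffel g x u)"
proof -
  note K = koszul_linear(2)[OF assms]
  have "linear (\<lambda>u. christoffel g x u v)" for v
    by (rule linearI; rule g_cancel[OF assms];
        simp only: g_simps[OF assms] g_christoffel[OF assms] linear_add[OF K] linear_cmul[OF K] real_scaleR_def)
  then show "linear (\<lambda>u. christoffel g x u v)" "linear (christoffel g x u)"
    using christoffel_commute[OF assms] by (auto simp: linear_iff)
qed

lemma smooth_on_christoffel: "smooth_on U (\<lambda>x. christoffel g x u v)"
  unfolding christoffel_eq_sharp
proof (rule smooth_on_sharp[OF koszul_linear(1)])
  fix w
  show "smooth_on U (\<lambda>x. (dg x u v w + dg x v u w - dg x w u v) / 2)"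
    unfolding dg_def
    by (intro smooth_on_divide smooth_on_diff smooth_on_add smooth_on_derivative smooth_on_const g_smooth open_U) simp
qed

lemma smooth_on_bilinear_family_along:
  fixes f :: "'a::real_normed_vector \<Rightarrow> real^'n" and \<beta> :: "real^'n \<Rightarrow> real^'n \<Rightarrow> real^'n \<Rightarrow> 'b::real_normed_vector"
  assumes "\<And>x. x \<in> U \<Longrightarrow> bilinear (\<beta> x)" "\<And>v w. smooth_on U (\<lambda>x. \<beta> x v w)"
    and "open S" "f ` S \<subseteq> U" "smooth_on S f" "smooth_on S X" "smooth_on S Y"
  shows "smooth_on S (\<lambda>x. \<beta> (f x) (X x) (Y x))"
proof -
  have l: "linear (\<beta> (f x) v)" "linear (\<lambda>v. \<beta> (f x) v w)" if "x \<in> S" for x v w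
    using assms(1)[of "f x"] assms(4) that by (auto simp: bilinear_def)
  have s: "smooth_on S (\<lambda>x. \<beta> (f x) v w)" for v w
    by (rule smooth_on_compose[OF assms(3-5) assms(2)])
  have "smooth_on S (\<lambda>x. \<beta> (f x) (X x) w)" for w
    by (rule smooth_on_linear_family[OF assms(3) l(2) s assms(6)])
  from smooth_on_linear_family[OF assms(3) l(1) this assms(7)] show ?thesis .
qed

lemma smooth_on_g_along:
  assumes "open S" "f ` S \<subseteq> U" "smooth_on S f" "smooth_on S X" "smooth_on S Y"
  shows "smooth_on S (\<lambda>x. g (f x) (X x) (Y x))"
  by (rule smooth_on_bilinear_family_along[OF g_bilinear g_smooth assms])

lemma christoffel_bilinear: "x \<in> U \<Longrightarrow> bilinear (christoffel g x)"
  by (simp add: bilinear_def christoffel_linear)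

lemma smooth_on_christoffel_along:
  assumes "open S" "f ` S \<subseteq> U" "smooth_on S f" "smooth_on S X" "smooth_on S Y"
  shows "smooth_on S (\<lambda>x. christoffel g (f x) (X x) (Y x))"
  by (rule smooth_on_bilinear_family_along[OF christoffel_bilinear smooth_on_christoffel assms])

lemma smooth_on_g: "smooth_on U X \<Longrightarrow> smooth_on U Y \<Longrightarrow> smooth_on U (\<lambda>x. g x (X x) (Y x))"
  using smooth_on_g_along[OF open_U, of "\<lambda>x. x"] smooth_on_ident[OF open_U] by simp

lemma smooth_on_nabla:
  assumes "smooth_on U V" "smooth_on U X"
  shows "smooth_on U (\<lambda>x. nabla g (V x) X x)"
  unfolding nabla_def
  using smooth_on_christoffel_along[OF open_U _ smooth_on_ident[OF open_U] assms]
  by (intro smooth_on_add smooth_on_derivative_along open_U assms) simp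

lemma nabla_linear:
  assumes "x \<in> U" "X differentiable (at x)" shows "linear (\<lambda>u. nabla g u X x)"
  unfolding nabla_def
  using linear_compose_add[OF linear_frechet_derivative[OF assms(2)] christoffel_linear(1)[OF assms(1)]] .

lemma nabla_add:
  assumes "x \<in> U" "X differentiable (at x)" "Y differentiable (at x)"
  shows "nabla g u (\<lambda>y. X y + Y y) x = nabla g u X x + nabla g u Y x"
  using frechet_derivative_at[OF has_derivative_add[OF assms(2,3)[unfolded frechet_derivative_works]]]
  by (simp add: nabla_def linear_add[OF christoffel_linear(2)[OF assms(1)]] fun_eq_iff)

lemma nabla_scaleR:
  assumes "x \<in> U" "a differentiable (at x)" "X differentiable (at x)"
  shows "nabla g u (\<lambda>y. a y *\<^sub>R X y) x = frechet_derivative a (at x) u *\<^sub>R X x + a x *\<^sub>R nabla g u X x"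
proof -
  have "frechet_derivative (\<lambda>y. a y *\<^sub>R X y) (at x)
      = (\<lambda>u. a x *\<^sub>R frechet_derivative X (at x) u + frechet_derivative a (at x) u *\<^sub>R X x)"
    by (rule frechet_derivative_at[OF has_derivative_scaleR[OF assms(2,3)[unfolded frechet_derivative_works]],
          symmetric])
  then show ?thesis
    by (simp add: nabla_def linear_cmul[OF christoffel_linear(2)[OF assms(1)]] algebra_simps)
qed

lemma nabla_cong:
  assumes "x \<in> U" "\<And>y. y \<in> U \<Longrightarrow> X y = Y y" "X differentiable (at x)"
  shows "nabla g u X x = nabla g u Y x"
  unfolding nabla_def
  using frechet_derivative_transform_within_open[OF assms(3) open_U assms(1,2)] assms(2)[OF assms(1)] by simp

text \<open>Of the three terms of the Koszul formula for \<open>g (\<Gamma>(u, X)) Y\<close>, two are skew in \<open>X, Y\<close>; adding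
  \<open>g X (\<Gamma>(u, Y))\<close> leaves the derivative of the metric itself.\<close>
lemma nabla_metric:
  assumes "x \<in> U" "X differentiable (at x)" "Y differentiable (at x)"
  shows "frechet_derivative (\<lambda>y. g y (X y) (Y y)) (at x) u
    = g x (nabla g u X x) (Y x) + g x (X x) (nabla g u Y x)"
proof -
  let ?X = "frechet_derivative X (at x)" and ?Y = "frechet_derivative Y (at x)"
  note X = assms(2)[unfolded frechet_derivative_works] and Y = assms(3)[unfolded frechet_derivative_works]
  have "((\<lambda>y. g y (X y) w) has_derivative (\<lambda>u. dg x u (X x) w + g x (?X u) w)) (at x)" for w
    by (rule has_derivative_linear_family[OF open_U assms(1) g_linear(2) dg_has_derivative[OF assms(1)] X])
  from has_derivative_linear_family[OF open_U assms(1) g_linear(1) this Y]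
  have "frechet_derivative (\<lambda>y. g y (X y) (Y y)) (at x)
      = (\<lambda>u. dg x u (X x) (Y x) + g x (?X u) (Y x) + g x (X x) (?Y u))"
    by (rule frechet_derivative_at[symmetric])
  moreover have "g x (christoffel g x u (X x)) (Y x) + g x (X x) (christoffel g x u (Y x)) = dg x u (X x) (Y x)"
    unfolding g_commute[OF assms(1), of "X x" "christoffel g x u (Y x)"] g_christoffel[OF assms(1)]
    by (simp add: dg_commute[OF assms(1), of _ "Y x" "X x"] field_simps)
  ultimately show ?thesis by (simp add: nabla_def g_simps[OF assms(1)])
qed

lemma nabla_torsion_free:
  assumes "x \<in> U"
  shows "nabla g (X x) Y x - nabla g (Y x) X x
    = frechet_derivative Y (at x) (X x) - frechet_derivative X (at x) (Y x)"
  by (simp add: nabla_def christoffel_commute[OF assms, of "X x"])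

text \<open>An orthonormal family is independent, and as it is indexed by the dimension it spans.\<close>
lemma orthonormal_expansion:
  assumes "x \<in> U" "orthonormal_basis g x e"
  shows "v = (\<Sum>i\<in>UNIV. g x v (e i) *\<^sub>R e i)"
proof -
  define T where "T z = (\<Sum>i\<in>UNIV. (z $ i) *\<^sub>R e i)" for z :: "real^'n"
  have g: "g x (T z) (e j) = z $ j" for z j
  proof -
    have "g x (T z) (e j) = (\<Sum>i\<in>UNIV. z $ i * g x (e i) (e j))"
      unfolding T_def linear_sum[OF g_linear(2)[OF assms(1)]] by (simp add: g_simps[OF assms(1)])
    also have "\<dots> = (\<Sum>i\<in>UNIV. if i = j then z $ i else 0)"
      using assms(2) unfolding orthonormal_basis_def by (intro sum.cong) auto
    also have "\<dots> = z $ j" by simp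
    finally show ?thesis .
  qed
  have "linear T"
    unfolding T_def by (rule linearI) (simp_all add: scaleR_left_distrib sum.distrib scaleR_sum_right)
  moreover have "inj T"
    by (rule injI) (metis g vec_eq_iff)
  ultimately obtain z where "v = T z"
    using linear_injective_imp_surjective by blast
  then show ?thesis using g by (simp add: T_def)
qed

text \<open>The change between two orthonormal bases is an orthogonal matrix \<open>Q\<close>, and the trace is unchanged
  because \<open>Q\<^sup>T Q = 1\<close>. This replaces the arbitrary choice in the definition of the trace by a
  frame that depends smoothly on the point.\<close>
lemma metric_trace_orthonormal:
  fixes \<beta> :: "real^'n \<Rightarrow> real^'n \<Rightarrow> 'b::real_vector"
  assumes "x \<in> U" "orthonormal_basis g x e" "bilinear \<beta>"
  shows "metric_trace g x \<beta> = (\<Sum>i\<in>UNIV. \<beta> (e i) (e i))"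
proof -
  define f where "f = onb g x"
  have f: "orthonormal_basis g x f"
    unfolding f_def onb_def by (rule someI[of "orthonormal_basis g x", OF assms(2)])
  define Q where "Q = ((\<chi> i j. g x (f i) (e j)) :: real^'n^'n)"
  have "(Q ** transpose Q) $ i $ j = mat 1 $ i $ j" for i j
  proof -
    have "g x (f i) (f j) = g x (f i) (\<Sum>k\<in>UNIV. g x (f j) (e k) *\<^sub>R e k)"
      using orthonormal_expansion[OF assms(1,2), of "f j"] by simp
    also have "\<dots> = (\<Sum>k\<in>UNIV. g x (f j) (e k) * g x (f i) (e k))"
      unfolding linear_sum[OF g_linear(1)[OF assms(1)]] by (simp add: g_simps[OF assms(1)])
    finally show ?thesis
      using f by (simp add: Q_def matrix_matrix_mult_def transpose_def mat_def orthonormal_basis_def mult.commute)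
  qed
  then have "Q ** transpose Q = mat 1" by (simp add: vec_eq_iff)
  then have "transpose Q ** Q = mat 1" by (simp add: matrix_left_right_inverse)
  then have "(transpose Q ** Q) $ j $ k = mat 1 $ j $ k" for j k by simp
  then have Q: "(\<Sum>i\<in>UNIV. g x (f i) (e j) * g x (f i) (e k)) = (if j = k then 1 else 0)" for j k
    by (simp add: Q_def matrix_matrix_mult_def transpose_def mat_def)
  have l: "linear (\<beta> u)" "linear (\<lambda>u. \<beta> u v)" for u v using assms(3) by (auto simp: bilinear_def)
  have "\<beta> (f i) (f i) = (\<Sum>j\<in>UNIV. \<Sum>k\<in>UNIV. (g x (f i) (e j) * g x (f i) (e k)) *\<^sub>R \<beta> (e j) (e k))" for i
  proof -
    have "\<beta> (f i) (f i) = \<beta> (\<Sum>j\<in>UNIV. g x (f i) (e j) *\<^sub>R e j) (\<Sum>k\<in>UNIV. g x (f i) (e k) *\<^sub>R e k)"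
      using orthonormal_expansion[OF assms(1,2), of "f i"] by simp
    also have "\<dots> = (\<Sum>k\<in>UNIV. \<Sum>j\<in>UNIV. (g x (f i) (e k) * g x (f i) (e j)) *\<^sub>R \<beta> (e j) (e k))"
      by (simp only: linear_sum[OF l(1)] linear_sum[OF l(2)] linear_cmul[OF l(1)] linear_cmul[OF l(2)]
          scaleR_sum_right scaleR_scaleR mult.commute)
    also have "\<dots> = (\<Sum>j\<in>UNIV. \<Sum>k\<in>UNIV. (g x (f i) (e k) * g x (f i) (e j)) *\<^sub>R \<beta> (e j) (e k))"
      by (rule sum.swap)
    also have "\<dots> = (\<Sum>j\<in>UNIV. \<Sum>k\<in>UNIV. (g x (f i) (e j) * g x (f i) (e k)) *\<^sub>R \<beta> (e j) (e k))"
      by (simp only: mult.commute)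
    finally show ?thesis .
  qed
  then have "metric_trace g x \<beta> = (\<Sum>i\<in>UNIV. \<Sum>j\<in>UNIV. \<Sum>k\<in>UNIV. (g x (f i) (e j) * g x (f i) (e k)) *\<^sub>R \<beta> (e j) (e k))"
    by (simp add: metric_trace_def f_def)
  also have "\<dots> = (\<Sum>j\<in>UNIV. \<Sum>i\<in>UNIV. \<Sum>k\<in>UNIV. (g x (f i) (e j) * g x (f i) (e k)) *\<^sub>R \<beta> (e j) (e k))"
    by (rule sum.swap)
  also have "\<dots> = (\<Sum>j\<in>UNIV. \<Sum>k\<in>UNIV. \<Sum>i\<in>UNIV. (g x (f i) (e j) * g x (f i) (e k)) *\<^sub>R \<beta> (e j) (e k))"
    by (rule sum.cong[OF refl]) (rule sum.swap)
  also have "\<dots> = (\<Sum>j\<in>UNIV. \<Sum>k\<in>UNIV. (if j = k then 1 else 0) *\<^sub>R \<beta> (e j) (e k))"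
    by (simp only: scaleR_sum_left[symmetric] Q)
  also have "\<dots> = (\<Sum>j\<in>UNIV. \<Sum>k\<in>UNIV. if j = k then \<beta> (e j) (e k) else 0)"
    by (intro sum.cong refl) simp
  also have "\<dots> = (\<Sum>j\<in>UNIV. \<beta> (e j) (e j))"
    by simp
  finally show ?thesis .
qed

end

section \<open>Surfaces in an orthonormal frame\<close>

locale surface_frame = chart_metric U g
  for U :: "(real^2) set" and g :: "2 local_metric" +
  fixes E1 E2 :: "real^2 \<Rightarrow> real^2"
  assumes E_smooth: "smooth_on U E1" "smooth_on U E2"
    and E_orthonormal: "x \<in> U \<Longrightarrow> g x (E1 x) (E1 x) = 1" "x \<in> U \<Longrightarrow> g x (E2 x) (E2 x) = 1"
      "x \<in> U \<Longrightarrow> g x (E1 x) (E2 x) = 0"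
begin

lemma E_orthonormal': "x \<in> U \<Longrightarrow> g x (E2 x) (E1 x) = 0"
  using g_commute E_orthonormal(3) by metis

lemma orthonormal_basis_frame:
  assumes "x \<in> U" shows "orthonormal_basis g x (\<lambda>i. if i = 1 then E1 x else E2 x)"
  using E_orthonormal[OF assms] E_orthonormal'[OF assms] unfolding orthonormal_basis_def
  by (simp add: forall_2)

lemma frame_expansion: "x \<in> U \<Longrightarrow> v = g x v (E1 x) *\<^sub>R E1 x + g x v (E2 x) *\<^sub>R E2 x"
  using orthonormal_expansion[OF _ orthonormal_basis_frame, of x v] by (simp add: UNIV_2)

text \<open>Stated for the sum itself, as the norms of tensors in the definitions are such sums too.\<close>
lemma frame_trace:
  fixes \<beta> :: "real^2 \<Rightarrow> real^2 \<Rightarrow> 'b::real_vector"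
  assumes "x \<in> U" "bilinear \<beta>"
  shows "(\<Sum>i\<in>UNIV. \<beta> (onb g x i) (onb g x i)) = \<beta> (E1 x) (E1 x) + \<beta> (E2 x) (E2 x)"
  using metric_trace_orthonormal[OF assms(1) orthonormal_basis_frame assms(2)] assms(1)
  by (simp add: metric_trace_def UNIV_2)

lemma frame_g: "x \<in> U \<Longrightarrow> g x u v = g x u (E1 x) * g x v (E1 x) + g x u (E2 x) * g x v (E2 x)"
  using arg_cong[OF frame_expansion[of x v], of "g x u"] by (simp add: g_simps algebra_simps)

abbreviation D1 :: "(real^2 \<Rightarrow> real) \<Rightarrow> real^2 \<Rightarrow> real" where
  "D1 f x \<equiv> frechet_derivative f (at x) (E1 x)"

abbreviation D2 :: "(real^2 \<Rightarrow> real) \<Rightarrow> real^2 \<Rightarrow> real" where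
  "D2 f x \<equiv> frechet_derivative f (at x) (E2 x)"

text \<open>The whole Levi-Civita connection of a surface is encoded in this 1-form, since an orthonormal
  frame can only rotate.\<close>
definition connection_form :: "real^2 \<Rightarrow> real^2 \<Rightarrow> real" where
  "connection_form u x = g x (nabla g u E1 x) (E2 x)"

definition \<omega>1 :: "real^2 \<Rightarrow> real" where "\<omega>1 x = connection_form (E1 x) x"
definition \<omega>2 :: "real^2 \<Rightarrow> real" where "\<omega>2 x = connection_form (E2 x) x"

lemma smooth_on_D:
  assumes "smooth_on U f" shows "smooth_on U (D1 f)" "smooth_on U (D2 f)"
  by (rule smooth_on_derivative_along[OF open_U assms E_smooth(1)],
      rule smooth_on_derivative_along[OF open_U assms E_smooth(2)])

lemma smooth_on_connection:
  "smooth_on U (connection_form u)" "smooth_on U \<omega>1" "smooth_on U \<omega>2"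
  unfolding connection_form_def[abs_def] \<omega>1_def[abs_def] \<omega>2_def[abs_def]
  by (intro smooth_on_g smooth_on_nabla smooth_on_const E_smooth)+

lemma connection_form_linear: "x \<in> U \<Longrightarrow> linear (\<lambda>u. connection_form u x)"
  using linear_compose[OF nabla_linear g_linear(2), of x E1 x "E2 x"]
    smooth_on_imp_differentiable[OF E_smooth(1)]
  by (simp add: connection_form_def comp_def)

lemma nabla_frame_field:
  assumes x: "x \<in> U"
  shows "nabla g u E1 x = connection_form u x *\<^sub>R E2 x"
    and "nabla g u E2 x = - connection_form u x *\<^sub>R E1 x"
proof -
  note d = smooth_on_imp_differentiable[OF E_smooth(1) x] smooth_on_imp_differentiable[OF E_smooth(2) x]
  have const: "frechet_derivative (\<lambda>y. g y (X y) (Y y)) (at x) u = 0"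
    if "\<And>y. y \<in> U \<Longrightarrow> g y (X y) (Y y) = r" for X Y r
    using fun_cong[OF frechet_derivative_cong[OF open_U x, of "\<lambda>_. r" "\<lambda>y. g y (X y) (Y y)"], of u] that
    by simp
  have "g x (nabla g u E1 x) (E1 x) = 0"
    using nabla_metric[OF x d(1,1), of u] const[OF E_orthonormal(1)] g_commute[OF x, of "E1 x"] by simp
  moreover have "g x (nabla g u E2 x) (E2 x) = 0"
    using nabla_metric[OF x d(2,2), of u] const[OF E_orthonormal(2)] g_commute[OF x, of "E2 x"] by simp
  moreover have "g x (nabla g u E2 x) (E1 x) = - connection_form u x"
    using nabla_metric[OF x d(1,2), of u] const[OF E_orthonormal(3)] g_commute[OF x, of "E1 x"]
    by (simp add: connection_form_def)
  ultimately show "nabla g u E1 x = connection_form u x *\<^sub>R E2 x"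
    and "nabla g u E2 x = - connection_form u x *\<^sub>R E1 x"
    using frame_expansion[OF x, of "nabla g u E1 x"] frame_expansion[OF x, of "nabla g u E2 x"]
    by (simp_all add: connection_form_def)
qed

lemma nabla_frame:
  assumes "x \<in> U" "smooth_on U p" "smooth_on U q" "\<And>y. y \<in> U \<Longrightarrow> V y = p y *\<^sub>R E1 y + q y *\<^sub>R E2 y"
  shows "nabla g u V x = (frechet_derivative p (at x) u - q x * connection_form u x) *\<^sub>R E1 x
    + (frechet_derivative q (at x) u + p x * connection_form u x) *\<^sub>R E2 x"
proof -
  note d = smooth_on_imp_differentiable[OF _ assms(1)]
  have s: "smooth_on U (\<lambda>y. p y *\<^sub>R E1 y)" "smooth_on U (\<lambda>y. q y *\<^sub>R E2 y)"
    by (intro smooth_on_scaleR open_U assms E_smooth)+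
  have "nabla g u V x = nabla g u (\<lambda>y. p y *\<^sub>R E1 y + q y *\<^sub>R E2 y) x"
    by (rule nabla_cong[OF assms(1), symmetric]) (simp_all add: assms(4) d[OF smooth_on_add[OF open_U s]])
  also have "\<dots> = nabla g u (\<lambda>y. p y *\<^sub>R E1 y) x + nabla g u (\<lambda>y. q y *\<^sub>R E2 y) x"
    by (rule nabla_add[OF assms(1) d[OF s(1)] d[OF s(2)]])
  finally show ?thesis
    by (simp add: nabla_scaleR[OF assms(1)] d assms E_smooth nabla_frame_field[OF assms(1)] algebra_simps)
qed

lemma divergence_frame:
  assumes "x \<in> U" "smooth_on U p" "smooth_on U q" "\<And>y. y \<in> U \<Longrightarrow> V y = p y *\<^sub>R E1 y + q y *\<^sub>R E2 y"
  shows "divergence g V x = D1 p x - q x * \<omega>1 x + D2 q x + p x * \<omega>2 x"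
proof -
  note d = smooth_on_imp_differentiable[OF _ assms(1)]
  have "smooth_on U (\<lambda>y. p y *\<^sub>R E1 y + q y *\<^sub>R E2 y)"
    by (intro smooth_on_add smooth_on_scaleR open_U assms E_smooth)
  then have "smooth_on U V" by (rule smooth_on_cong[OF open_U, rotated]) (simp add: assms(4))
  then have lin: "linear (\<lambda>u. nabla g u V x)" by (intro nabla_linear assms(1) d)
  have "bilinear (\<lambda>u v. g x (nabla g u V x) v)"
    unfolding bilinear_def using g_linear(1)[OF assms(1)] linear_compose[OF lin g_linear(2)[OF assms(1)]]
    by (simp add: comp_def)
  then have "divergence g V x = g x (nabla g (E1 x) V x) (E1 x) + g x (nabla g (E2 x) V x) (E2 x)"
    unfolding divergence_def metric_trace_def by (rule frame_trace[OF assms(1)])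
  moreover have "nabla g u V x = (frechet_derivative p (at x) u - q x * connection_form u x) *\<^sub>R E1 x
    + (frechet_derivative q (at x) u + p x * connection_form u x) *\<^sub>R E2 x" for u
    by (rule nabla_frame[OF assms])
  ultimately show ?thesis
    by (simp add: g_simps[OF assms(1)] E_orthonormal[OF assms(1)] E_orthonormal'[OF assms(1)] \<omega>1_def \<omega>2_def)
qed

lemma grad_frame:
  assumes "x \<in> U" "f differentiable (at x)"
  shows "grad g f x = D1 f x *\<^sub>R E1 x + D2 f x *\<^sub>R E2 x"
  unfolding grad_def
proof (rule sharp_eqI[OF assms(1)])
  fix w
  have "frechet_derivative f (at x) w
      = frechet_derivative f (at x) (g x w (E1 x) *\<^sub>R E1 x + g x w (E2 x) *\<^sub>R E2 x)"
    using frame_expansion[OF assms(1), of w] by simp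
  also have "\<dots> = g x w (E1 x) * D1 f x + g x w (E2 x) * D2 f x"
    using linear_frechet_derivative[OF assms(2)] by (simp add: linear_add linear_cmul)
  finally show "g x (D1 f x *\<^sub>R E1 x + D2 f x *\<^sub>R E2 x) w = frechet_derivative f (at x) w"
    by (simp add: g_simps[OF assms(1)] g_commute[OF assms(1), of _ w])
qed

lemma laplacian_frame:
  assumes "x \<in> U" "smooth_on U f"
  shows "laplacian g f x = - (D1 (D1 f) x - D2 f x * \<omega>1 x + D2 (D2 f) x + D1 f x * \<omega>2 x)"
proof -
  have "divergence g (grad g f) x = D1 (D1 f) x - D2 f x * \<omega>1 x + D2 (D2 f) x + D1 f x * \<omega>2 x"
    by (rule divergence_frame[OF assms(1) smooth_on_D[OF assms(2)] grad_frame])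
      (simp_all add: smooth_on_imp_differentiable[OF assms(2)])
  then show ?thesis by (simp add: laplacian_def)
qed

lemma D_cong:
  assumes "x \<in> U" "\<And>y. y \<in> U \<Longrightarrow> f y = h y" "smooth_on U f"
  shows "D1 f x = D1 h x" "D2 f x = D2 h x"
  using frechet_derivative_cong[OF open_U assms(1,2) smooth_on_imp_differentiable[OF assms(3,1)]] by simp_all

lemma laplacian_cong:
  assumes "x \<in> U" "\<And>y. y \<in> U \<Longrightarrow> f y = h y" "smooth_on U f"
  shows "laplacian g f x = laplacian g h x"
proof -
  have h: "smooth_on U h" by (rule smooth_on_cong[OF open_U assms(2,3)])
  note D = D_cong[OF _ assms(2,3)]
  show ?thesis
    unfolding laplacian_frame[OF assms(1,3)] laplacian_frame[OF assms(1) h]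
    using D[OF assms(1)] D_cong(1)[OF assms(1) D(1) smooth_on_D(1)[OF assms(3)]]
      D_cong(2)[OF assms(1) D(2) smooth_on_D(2)[OF assms(3)]] by simp
qed

lemma D_add:
  assumes "x \<in> U" "smooth_on U f" "smooth_on U h"
  shows "D1 (\<lambda>y. f y + h y) x = D1 f x + D1 h x" "D2 (\<lambda>y. f y + h y) x = D2 f x + D2 h x"
  by (simp_all add: frechet_derivative_add smooth_on_imp_differentiable[OF _ assms(1)] assms)

lemma D_diff:
  assumes "x \<in> U" "smooth_on U f" "smooth_on U h"
  shows "D1 (\<lambda>y. f y - h y) x = D1 f x - D1 h x" "D2 (\<lambda>y. f y - h y) x = D2 f x - D2 h x"
  by (simp_all add: frechet_derivative_diff smooth_on_imp_differentiable[OF _ assms(1)] assms)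

lemma D_mult:
  assumes "x \<in> U" "smooth_on U f" "smooth_on U h"
  shows "D1 (\<lambda>y. f y * h y) x = D1 f x * h x + f x * D1 h x"
    "D2 (\<lambda>y. f y * h y) x = D2 f x * h x + f x * D2 h x"
  by (simp_all add: frechet_derivative_mult smooth_on_imp_differentiable[OF _ assms(1)] assms)

lemma laplacian_add:
  assumes "x \<in> U" "smooth_on U f" "smooth_on U h"
  shows "laplacian g (\<lambda>y. f y + h y) x = laplacian g f x + laplacian g h x"
proof -
  note s = smooth_on_D[OF assms(2)] smooth_on_D[OF assms(3)]
  have "D1 (D1 (\<lambda>y. f y + h y)) x = D1 (\<lambda>y. D1 f y + D1 h y) x"
    "D2 (D2 (\<lambda>y. f y + h y)) x = D2 (\<lambda>y. D2 f y + D2 h y) x"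
    by (rule D_cong[symmetric, OF assms(1)]; simp add: D_add assms smooth_on_add[OF open_U] s)+
  then show ?thesis
    by (simp add: laplacian_frame assms smooth_on_add[OF open_U] D_add s algebra_simps)
qed

lemma laplacian_mult:
  assumes "x \<in> U" "smooth_on U f" "smooth_on U h"
  shows "laplacian g (\<lambda>y. f y * h y) x = f x * laplacian g h x + h x * laplacian g f x
    - 2 * (D1 f x * D1 h x + D2 f x * D2 h x)"
proof -
  note s = smooth_on_D[OF assms(2)] smooth_on_D[OF assms(3)]
  have "D1 (D1 (\<lambda>y. f y * h y)) x = D1 (\<lambda>y. D1 f y * h y + f y * D1 h y) x"
    "D2 (D2 (\<lambda>y. f y * h y)) x = D2 (\<lambda>y. D2 f y * h y + f y * D2 h y) x"
    by (rule D_cong[symmetric, OF assms(1)]; simp add: D_mult assms smooth_on_add[OF open_U] smooth_on_mult[OF open_U] s)+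
  then show ?thesis
    by (simp add: laplacian_frame assms smooth_on_add[OF open_U] smooth_on_mult[OF open_U] D_add D_mult s algebra_simps)
qed

text \<open>The derivative of \<open>L (V)\<close> splits into the part with the vector \<open>V x\<close> frozen and the part from the
  variation of \<open>V\<close>. With \<open>V\<close> a frame field, the second part is what produces the Lie bracket of
  the frame.\<close>
lemma derivative_of_linear_family_along:
  fixes L :: "real^2 \<Rightarrow> real^2 \<Rightarrow> 'c::real_normed_vector"
  assumes "x \<in> U" "\<And>y. y \<in> U \<Longrightarrow> linear (L y)" "\<And>v. smooth_on U (\<lambda>y. L y v)" "smooth_on U V"
  shows "frechet_derivative (\<lambda>y. L y (V y)) (at x) u
    = frechet_derivative (\<lambda>y. L y (V x)) (at x) u + L x (frechet_derivative V (at x) u)"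
  using frechet_derivative_at[OF has_derivative_linear_family[OF open_U assms(1,2)
    smooth_on_imp_differentiable[OF assms(3,1), unfolded frechet_derivative_works]
    smooth_on_imp_differentiable[OF assms(4,1), unfolded frechet_derivative_works]]]
  by (simp add: fun_eq_iff)

text \<open>The components of the Lie bracket \<open>[E\<^sub>1, E\<^sub>2]\<close>, from the vanishing of torsion.\<close>
lemma frame_bracket:
  assumes "x \<in> U"
  shows "frechet_derivative E2 (at x) (E1 x) - frechet_derivative E1 (at x) (E2 x)
    = - \<omega>1 x *\<^sub>R E1 x - \<omega>2 x *\<^sub>R E2 x"
  using nabla_torsion_free[OF assms, of E1 E2]
  by (simp add: nabla_frame_field[OF assms] \<omega>1_def \<omega>2_def)

lemma D_commutator:
  assumes "x \<in> U" "smooth_on U f"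
  shows "D1 (D2 f) x - D2 (D1 f) x = - \<omega>1 x * D1 f x - \<omega>2 x * D2 f x"
proof -
  have l: "linear (frechet_derivative f (at y))" if "y \<in> U" for y
    using linear_frechet_derivative[OF smooth_on_imp_differentiable[OF assms(2) that]] .
  have along: "frechet_derivative (\<lambda>y. frechet_derivative f (at y) (V y)) (at x) u
      = frechet_derivative (\<lambda>y. frechet_derivative f (at y) (V x)) (at x) u
        + frechet_derivative f (at x) (frechet_derivative V (at x) u)" if "smooth_on U V" for V u
    by (rule derivative_of_linear_family_along[OF assms(1) l smooth_on_derivative[OF assms(2)] that])
  have "D1 (D2 f) x - D2 (D1 f) x = frechet_derivative f (at x)
      (frechet_derivative E2 (at x) (E1 x) - frechet_derivative E1 (at x) (E2 x))"
    unfolding along[OF E_smooth(1)] along[OF E_smooth(2)]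
    by (simp add: second_derivative_symmetric[OF open_U assms(2,1), of "E1 x"] linear_diff[OF l[OF assms(1)]])
  also have "\<dots> = - \<omega>1 x * D1 f x - \<omega>2 x * D2 f x"
    unfolding frame_bracket[OF assms(1)]
    by (simp add: linear_diff[OF l[OF assms(1)]] linear_cmul[OF l[OF assms(1)]] linear_neg[OF l[OF assms(1)]])
  finally show ?thesis .
qed

text \<open>In \<open>\<nabla>\<^sub>u \<nabla>\<^sub>v c\<close>, written out in the frame, everything except the derivative of \<open>\<omega>\<close> is symmetric in
  \<open>u, v\<close>: rotations of the plane commute, so \<open>\<omega> \<and> \<omega>\<close> does not contribute.\<close>
lemma curvature_frame:
  assumes x: "x \<in> U"
  shows "curvature g x u v c =
    (frechet_derivative (connection_form v) (at x) u - frechet_derivative (connection_form u) (at x) v) *\<^sub>R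
      (g x c (E1 x) *\<^sub>R E2 x - g x c (E2 x) *\<^sub>R E1 x)"
proof -
  define p q where "p = (\<lambda>y. g y c (E1 y))" and "q = (\<lambda>y. g y c (E2 y))"
  have s: "smooth_on U p" "smooth_on U q"
    unfolding p_def q_def by (intro smooth_on_g smooth_on_const E_smooth)+
  have c: "c = p y *\<^sub>R E1 y + q y *\<^sub>R E2 y" if "y \<in> U" for y
    unfolding p_def q_def by (rule frame_expansion[OF that])
  note d = smooth_on_imp_differentiable[OF _ x]
  have second: "nabla g u (nabla g v (\<lambda>_. c)) x =
      (frechet_derivative (\<lambda>y. frechet_derivative p (at y) v) (at x) u
       - (frechet_derivative q (at x) u * connection_form v x + q x * frechet_derivative (connection_form v) (at x) u)
       - (frechet_derivative q (at x) v + p x * connection_form v x) * connection_form u x) *\<^sub>R E1 x +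
      (frechet_derivative (\<lambda>y. frechet_derivative q (at y) v) (at x) u
       + (frechet_derivative p (at x) u * connection_form v x + p x * frechet_derivative (connection_form v) (at x) u)
       + (frechet_derivative p (at x) v - q x * connection_form v x) * connection_form u x) *\<^sub>R E2 x" for u v
  proof -
    have s': "smooth_on U (\<lambda>y. q y * connection_form v y)" "smooth_on U (\<lambda>y. p y * connection_form v y)"
      "smooth_on U (\<lambda>y. frechet_derivative p (at y) v)" "smooth_on U (\<lambda>y. frechet_derivative q (at y) v)"
      by (intro smooth_on_mult smooth_on_derivative open_U s smooth_on_connection)+
    show ?thesis
      by (subst nabla_frame[OF x smooth_on_diff[OF open_U s'(3,1)] smooth_on_add[OF open_U s'(4,2)]
            nabla_frame[OF _ s c]])
        (simp_all add: frechet_derivative_diff frechet_derivative_add frechet_derivative_mult d s s' smooth_on_connection)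
  qed
  show ?thesis
    unfolding curvature_def second
    by (simp add: second_derivative_symmetric[OF open_U _ x, of _ u v] s algebra_simps)
      (simp add: p_def q_def)
qed

text \<open>Cartan's structure equation \<open>K = -d\<omega>(E\<^sub>1, E\<^sub>2)\<close>. The quadratic terms come from the bracket, as
  \<open>d\<omega>(E\<^sub>1, E\<^sub>2) = E\<^sub>1 \<omega>(E\<^sub>2) - E\<^sub>2 \<omega>(E\<^sub>1) - \<omega>([E\<^sub>1, E\<^sub>2])\<close>. The curvature is defined with coordinate
  vectors \<open>u, v\<close>; their area with respect to the frame appears once in \<open>d\<omega>(u, v)\<close>, once in the
  pairing with \<open>u\<close>, and squared in the Gram determinant, so it cancels.\<close>

lemma gauss_curvature_frame:
  assumes x: "x \<in> U"
  shows "gauss_curvature g x = - (D1 \<omega>2 x - D2 \<omega>1 x + (\<omega>1 x)\<^sup>2 + (\<omega>2 x)\<^sup>2)"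
proof -
  define \<Omega> where "\<Omega> u v = frechet_derivative (connection_form v) (at x) u
    - frechet_derivative (connection_form u) (at x) v" for u v
  have lin1: "linear (frechet_derivative (connection_form v) (at x))" for v
    by (rule linear_frechet_derivative[OF smooth_on_imp_differentiable[OF smooth_on_connection(1) x]])
  have lin2: "linear (\<lambda>v. frechet_derivative (connection_form v) (at x) u)" for u
    by (rule linear_derivative_of_linear_family[OF open_U x connection_form_linear
          smooth_on_imp_differentiable[OF smooth_on_connection(1) x]])
  define u v :: "real^2" where "u = axis 1 1" and "v = axis 2 1"
  define u1 u2 v1 v2 where "u1 = g x u (E1 x)" and "u2 = g x u (E2 x)" and "v1 = g x v (E1 x)" and "v2 = g x v (E2 x)"
  have u: "u = u1 *\<^sub>R E1 x + u2 *\<^sub>R E2 x" and v: "v = v1 *\<^sub>R E1 x + v2 *\<^sub>R E2 x"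
    unfolding u1_def u2_def v1_def v2_def by (rule frame_expansion[OF x])+
  have \<Omega>: "\<Omega> u v = (u1 * v2 - u2 * v1) * \<Omega> (E1 x) (E2 x)"
    unfolding \<Omega>_def u v
    by (simp add: linear_add[OF lin1] linear_cmul[OF lin1] linear_add[OF lin2] linear_cmul[OF lin2] algebra_simps)
  have det: "u1 * v2 - u2 * v1 \<noteq> 0"
  proof
    assume 0: "u1 * v2 - u2 * v1 = 0"
    have "u1 *\<^sub>R v - v1 *\<^sub>R u = (u1 * v2 - u2 * v1) *\<^sub>R E2 x" "v2 *\<^sub>R u - u2 *\<^sub>R v = (u1 * v2 - u2 * v1) *\<^sub>R E1 x"
      unfolding u v by (simp_all add: algebra_simps)
    then have "u1 *\<^sub>R v - v1 *\<^sub>R u = 0" "v2 *\<^sub>R u - u2 *\<^sub>R v = 0" using 0 by simp_all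
    then have "(u1 *\<^sub>R v - v1 *\<^sub>R u) $ 2 = 0" "(v2 *\<^sub>R u - u2 *\<^sub>R v) $ 2 = 0" by simp_all
    then have "u1 = 0" "u2 = 0" by (simp_all add: u_def v_def axis_def)
    then have "u = 0" using u by simp
    then show False by (simp add: u_def axis_eq_0_iff)
  qed
  have "g x u u * g x v v - (g x u v)\<^sup>2 = (u1 * v2 - u2 * v1)\<^sup>2"
    unfolding frame_g[OF x, of u u] frame_g[OF x, of v v] frame_g[OF x, of u v]
    by (simp add: u1_def[symmetric] u2_def[symmetric] v1_def[symmetric] v2_def[symmetric] algebra_simps power2_eq_square)
  moreover have "g x (curvature g x u v v) u = - \<Omega> u v * (u1 * v2 - u2 * v1)"
    unfolding curvature_frame[OF x] \<Omega>_def[symmetric]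
    by (simp add: g_simps[OF x] g_commute[OF x, of _ u] u1_def u2_def v1_def v2_def algebra_simps)
  ultimately have "gauss_curvature g x = - \<Omega> (E1 x) (E2 x)"
    using det unfolding gauss_curvature_def sectional_curvature_def u_def[symmetric] v_def[symmetric] \<Omega>
    by (simp add: power2_eq_square)
  moreover have "D1 \<omega>2 x - D2 \<omega>1 x = \<Omega> (E1 x) (E2 x) - (\<omega>1 x)\<^sup>2 - (\<omega>2 x)\<^sup>2"
  proof -
    note l = connection_form_linear[OF x]
    have along: "frechet_derivative (\<lambda>y. connection_form (V y) y) (at x) u
      = frechet_derivative (connection_form (V x)) (at x) u
        + connection_form (frechet_derivative V (at x) u) x" if "smooth_on U V" for V u
      by (rule derivative_of_linear_family_along[of x "\<lambda>y v. connection_form v y",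
            OF x connection_form_linear smooth_on_connection(1) that])
    have "D1 \<omega>2 x - D2 \<omega>1 x = \<Omega> (E1 x) (E2 x)
        + connection_form (frechet_derivative E2 (at x) (E1 x) - frechet_derivative E1 (at x) (E2 x)) x"
      unfolding \<omega>1_def[abs_def] \<omega>2_def[abs_def]
      using along[OF E_smooth(1), of "E2 x"] along[OF E_smooth(2), of "E1 x"]
      by (simp add: \<Omega>_def linear_diff[OF l])
    then show ?thesis
      unfolding frame_bracket[OF x]
      by (simp add: linear_diff[OF l] linear_cmul[OF l] linear_neg[OF l] \<omega>1_def[symmetric] \<omega>2_def[symmetric] power2_eq_square)
  qed
  ultimately show ?thesis by simp
qed

text \<open>The covariant derivative of a tensor field is defined by extending the vector to a coordinate
  field; any other extension, in particular by a frame field, gives the same.\<close>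
lemma nabla_tensor_along:
  assumes "x \<in> U" "\<And>y. y \<in> U \<Longrightarrow> linear (S y)" "\<And>v. smooth_on U (\<lambda>y. S y v)" "smooth_on U V"
  shows "nabla_tensor g u S x (V x) = nabla g u (\<lambda>y. S y (V y)) x - S x (nabla g u V x)"
proof -
  have "frechet_derivative (\<lambda>y. S y (V y)) (at x) u
    = frechet_derivative (\<lambda>y. S y (V x)) (at x) u + S x (frechet_derivative V (at x) u)"
    by (rule derivative_of_linear_family_along[OF assms])
  then show ?thesis
    by (simp add: nabla_tensor_def nabla_def linear_add[OF assms(2)[OF assms(1)]])
qed

lemma nabla_tensor_bilinear:
  assumes "x \<in> U" "\<And>y. y \<in> U \<Longrightarrow> linear (S y)" "\<And>v. smooth_on U (\<lambda>y. S y v)"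
  shows "bilinear (\<lambda>u v. nabla_tensor g u S x v)"
proof -
  note S = assms(2)[OF assms(1)] and d = smooth_on_imp_differentiable[OF assms(3,1)]
  note l1 = linear_frechet_derivative[OF d] and C = christoffel_linear[OF assms(1)]
  have l2: "linear (\<lambda>v. frechet_derivative (\<lambda>y. S y v) (at x) u)" for u
    by (rule linear_derivative_of_linear_family[OF open_U assms(1,2) d])
  show ?thesis
    unfolding bilinear_def nabla_tensor_def nabla_def
    by (safe; rule linearI; simp add: linear_add[OF S] linear_cmul[OF S] linear_add[OF l1] linear_cmul[OF l1]
      linear_add[OF l2] linear_cmul[OF l2] linear_add[OF C(1)] linear_cmul[OF C(1)]
      linear_add[OF C(2)] linear_cmul[OF C(2)] algebra_simps)
qed

section \<open>A Bochner formula for divergence-free tensor fields\<close>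

text \<open>The unknowns are the components \<open>a, b, c\<close> of \<open>S\<close> in the frame. Both sides are expressed through
  these functions and \<open>\<omega>\<close>, with their derivatives along the frame at \<open>x\<close>. The two equations
  \<open>div S = 0\<close> eliminate two of the first derivatives, their four derivatives along \<open>E\<^sub>1, E\<^sub>2\<close> eliminate
  four of the second derivatives, and the commutators eliminate three more; what is left agrees
  identically once \<open>K\<close> is replaced by the structure equation.\<close>
lemma bochner_divergence_free:
  assumes lin: "\<And>y. y \<in> U \<Longrightarrow> linear (S y)"
    and symm: "\<And>y u v. y \<in> U \<Longrightarrow> g y (S y u) v = g y u (S y v)"
    and smooth: "\<And>v. smooth_on U (\<lambda>y. S y v)"
    and div: "\<And>y. y \<in> U \<Longrightarrow> tensor_divergence g S y = 0"
    and trace: "\<And>y. y \<in> U \<Longrightarrow> t y = metric_trace g y (\<lambda>u v. g y (S y u) v)"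
    and x: "x \<in> U"
  shows "1 / 2 * laplacian g (tensor_norm_sq g S) x =
         - 2 * gauss_curvature g x * tensor_norm_sq g S x
         + divergence g (\<lambda>y. sharp g y (\<lambda>u. g y (S y u) (grad g t y))) x
         + gauss_curvature g x * (t x)\<^sup>2
         + 1 / 2 * laplacian g (\<lambda>y. (t y)\<^sup>2) x
         + vec_norm_sq g x (grad g t x)
         - nabla_tensor_norm_sq g S x"
proof -
  define a b c where "a = (\<lambda>y. g y (S y (E1 y)) (E1 y))" and "b = (\<lambda>y. g y (S y (E1 y)) (E2 y))"
    and "c = (\<lambda>y. g y (S y (E2 y)) (E2 y))"
  have SE: "smooth_on U (\<lambda>y. S y (E y))" if "smooth_on U E" for E
    by (rule smooth_on_linear_family[OF open_U lin smooth that])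
  have abc: "smooth_on U a" "smooth_on U b" "smooth_on U c"
    unfolding a_def b_def c_def by (intro smooth_on_g SE E_smooth)+
  have b': "g y (S y (E2 y)) (E1 y) = b y" if "y \<in> U" for y
    unfolding b_def using symm[OF that] g_commute[OF that] by metis
  have S1: "S y (E1 y) = a y *\<^sub>R E1 y + b y *\<^sub>R E2 y" if "y \<in> U" for y
    using frame_expansion[OF that, of "S y (E1 y)"] by (simp add: a_def b_def)
  have S2: "S y (E2 y) = b y *\<^sub>R E1 y + c y *\<^sub>R E2 y" if "y \<in> U" for y
    using frame_expansion[OF that, of "S y (E2 y)"] by (simp add: b'[OF that] c_def)
  note ortho = E_orthonormal E_orthonormal'

  have N1: "nabla_tensor g u S y (E1 y) =
      (frechet_derivative a (at y) u - 2 * b y * connection_form u y) *\<^sub>R E1 y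
      + (frechet_derivative b (at y) u + (a y - c y) * connection_form u y) *\<^sub>R E2 y" if y: "y \<in> U" for y u
  proof -
    have "nabla g u (\<lambda>y. S y (E1 y)) y = (frechet_derivative a (at y) u - b y * connection_form u y) *\<^sub>R E1 y
      + (frechet_derivative b (at y) u + a y * connection_form u y) *\<^sub>R E2 y"
      by (rule nabla_frame[OF y abc(1,2) S1])
    note * = nabla_tensor_along[OF y lin smooth E_smooth(1)] this
    have "nabla_tensor g u S y (E1 y) =
      (frechet_derivative a (at y) u - b y * connection_form u y - b y * connection_form u y) *\<^sub>R E1 y
      + (frechet_derivative b (at y) u + a y * connection_form u y - c y * connection_form u y) *\<^sub>R E2 y"
      by (simp only: *) (simp add: nabla_frame_field[OF y]
          linear_cmul[OF lin[OF y]] S2[OF y] vec_eq_iff algebra_simps)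
    also have "frechet_derivative a (at y) u - b y * connection_form u y - b y * connection_form u y
      = frechet_derivative a (at y) u - 2 * b y * connection_form u y" by simp
    also have "frechet_derivative b (at y) u + a y * connection_form u y - c y * connection_form u y
      = frechet_derivative b (at y) u + (a y - c y) * connection_form u y" by (simp add: algebra_simps)
    finally show ?thesis .
  qed
  have N2: "nabla_tensor g u S y (E2 y) =
      (frechet_derivative b (at y) u + (a y - c y) * connection_form u y) *\<^sub>R E1 y
      + (frechet_derivative c (at y) u + 2 * b y * connection_form u y) *\<^sub>R E2 y" if y: "y \<in> U" for y u
  proof -
    have "nabla g u (\<lambda>y. S y (E2 y)) y = (frechet_derivative b (at y) u - c y * connection_form u y) *\<^sub>R E1 y
      + (frechet_derivative c (at y) u + b y * connection_form u y) *\<^sub>R E2 y"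
      by (rule nabla_frame[OF y abc(2,3) S2])
    note * = nabla_tensor_along[OF y lin smooth E_smooth(2)] this
    have "nabla_tensor g u S y (E2 y) =
      (frechet_derivative b (at y) u + a y * connection_form u y - c y * connection_form u y) *\<^sub>R E1 y
      + (frechet_derivative c (at y) u + b y * connection_form u y + b y * connection_form u y) *\<^sub>R E2 y"
      by (simp only: *) (simp add: nabla_frame_field[OF y]
          linear_cmul[OF lin[OF y]] linear_neg[OF lin[OF y]] S1[OF y] vec_eq_iff algebra_simps)
    also have "frechet_derivative b (at y) u + a y * connection_form u y - c y * connection_form u y
      = frechet_derivative b (at y) u + (a y - c y) * connection_form u y" by (simp add: algebra_simps)
    also have "frechet_derivative c (at y) u + b y * connection_form u y + b y * connection_form u y
      = frechet_derivative c (at y) u + 2 * b y * connection_form u y" by simp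
    finally show ?thesis .
  qed
  have N: "bilinear (\<lambda>u v. nabla_tensor g u S y v)" if "y \<in> U" for y
    by (rule nabla_tensor_bilinear[OF that lin smooth])

  have t: "t y = a y + c y" if y: "y \<in> U" for y
  proof -
    have "bilinear (\<lambda>u v. g y (S y u) v)"
      unfolding bilinear_def using g_linear(1)[OF y] linear_compose[OF lin[OF y] g_linear(2)[OF y]]
      by (simp add: comp_def)
    from frame_trace[OF y this] show ?thesis
      by (simp add: trace[OF y] metric_trace_def a_def c_def)
  qed
  have norm: "tensor_norm_sq g S y = a y * a y + (b y * b y + b y * b y) + c y * c y" if y: "y \<in> U" for y
  proof -
    have "bilinear (\<lambda>u v. g y (S y u) (S y v))"
      unfolding bilinear_def
      using linear_compose[OF lin[OF y] g_linear(1)[OF y]] linear_compose[OF lin[OF y] g_linear(2)[OF y]]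
      by (simp add: comp_def)
    from frame_trace[OF y this] show ?thesis
      by (simp add: tensor_norm_sq_def vec_norm_sq_def S1[OF y] S2[OF y] g_simps[OF y] ortho[OF y])
  qed
  have div1: "D1 a y - 2 * b y * \<omega>1 y + D2 b y + (a y - c y) * \<omega>2 y = 0"
    and div2: "D1 b y + (a y - c y) * \<omega>1 y + D2 c y + 2 * b y * \<omega>2 y = 0" if y: "y \<in> U" for y
  proof -
    have "nabla_tensor g (E1 y) S y (E1 y) + nabla_tensor g (E2 y) S y (E2 y) = 0"
      using div[OF y] frame_trace[OF y N[OF y]] by (simp add: tensor_divergence_def metric_trace_def)
    then have "g y (nabla_tensor g (E1 y) S y (E1 y) + nabla_tensor g (E2 y) S y (E2 y)) w = 0" for w
      by (simp add: g_simps[OF y])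
    from this[of "E1 y"] this[of "E2 y"]
    show "D1 a y - 2 * b y * \<omega>1 y + D2 b y + (a y - c y) * \<omega>2 y = 0"
      and "D1 b y + (a y - c y) * \<omega>1 y + D2 c y + 2 * b y * \<omega>2 y = 0"
      by (simp_all add: N1[OF y] N2[OF y] g_simps[OF y] ortho[OF y] \<omega>1_def \<omega>2_def)
  qed

  have normN: "nabla_tensor_norm_sq g S x =
      (D1 a x - 2 * b x * \<omega>1 x)\<^sup>2 + 2 * (D1 b x + (a x - c x) * \<omega>1 x)\<^sup>2 + (D1 c x + 2 * b x * \<omega>1 x)\<^sup>2
      + (D2 a x - 2 * b x * \<omega>2 x)\<^sup>2 + 2 * (D2 b x + (a x - c x) * \<omega>2 x)\<^sup>2 + (D2 c x + 2 * b x * \<omega>2 x)\<^sup>2"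
  proof -
    have l: "linear (\<lambda>u. nabla_tensor g u S x v)" "linear (nabla_tensor g u S x)" for u v
      using N[OF x] by (auto simp: bilinear_def)
    have "bilinear (\<lambda>v w. g x (nabla_tensor g u S x v) (nabla_tensor g u S x w))" for u
      unfolding bilinear_def
      using linear_compose[OF l(2) g_linear(1)[OF x]] linear_compose[OF l(2) g_linear(2)[OF x]]
      by (simp add: comp_def)
    note inner = frame_trace[OF x this]
    have "bilinear (\<lambda>u w. g x (nabla_tensor g u S x v) (nabla_tensor g w S x v))" for v
      unfolding bilinear_def
      using linear_compose[OF l(1) g_linear(1)[OF x]] linear_compose[OF l(1) g_linear(2)[OF x]]
      by (simp add: comp_def)
    note outer = frame_trace[OF x this]
    show ?thesis
      unfolding nabla_tensor_norm_sq_def vec_norm_sq_def inner sum.distrib outer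
      by (simp add: N1[OF x] N2[OF x] g_simps[OF x] ortho[OF x] \<omega>1_def[symmetric] \<omega>2_def[symmetric] power2_eq_square)
  qed

  define T where "T = (\<lambda>y. a y + c y)"
  have T: "smooth_on U T" unfolding T_def by (intro smooth_on_add open_U abc)
  have t_T: "t y = T y" if "y \<in> U" for y using t[OF that] by (simp add: T_def)
  have t_smooth: "smooth_on U t" by (rule smooth_on_cong[OF open_U t_T[symmetric] T])
  have DT: "D1 T y = D1 a y + D1 c y" "D2 T y = D2 a y + D2 c y" if "y \<in> U" for y
    unfolding T_def using D_add[OF that abc(1,3)] by simp_all
  have grad_t: "grad g t y = D1 T y *\<^sub>R E1 y + D2 T y *\<^sub>R E2 y" if y: "y \<in> U" for y
    using grad_frame[OF y smooth_on_imp_differentiable[OF t_smooth y]] D_cong[OF y t_T t_smooth] by simp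
  define p q where "p = (\<lambda>y. a y * D1 T y + b y * D2 T y)" and "q = (\<lambda>y. b y * D1 T y + c y * D2 T y)"
  have pq: "smooth_on U p" "smooth_on U q"
    unfolding p_def q_def by (intro smooth_on_add smooth_on_mult open_U abc smooth_on_D T)+
  have field: "sharp g y (\<lambda>u. g y (S y u) (grad g t y)) = p y *\<^sub>R E1 y + q y *\<^sub>R E2 y" if y: "y \<in> U" for y
  proof (rule sharp_eqI[OF y])
    fix w
    have "S y (grad g t y) = p y *\<^sub>R E1 y + q y *\<^sub>R E2 y"
      by (simp add: grad_t[OF y] linear_add[OF lin[OF y]] linear_cmul[OF lin[OF y]] S1[OF y] S2[OF y]
          p_def q_def algebra_simps)
    then show "g y (p y *\<^sub>R E1 y + q y *\<^sub>R E2 y) w = g y (S y w) (grad g t y)"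
      using symm[OF y, of w] g_commute[OF y] by metis
  qed
  have div_field: "divergence g (\<lambda>y. sharp g y (\<lambda>u. g y (S y u) (grad g t y))) x
      = D1 p x - q x * \<omega>1 x + D2 q x + p x * \<omega>2 x"
    by (rule divergence_frame[OF x pq field])

  have Dp: "D1 p x = D1 a x * D1 T x + a x * D1 (D1 T) x + (D1 b x * D2 T x + b x * D1 (D2 T) x)"
    unfolding p_def by (simp add: D_add[OF x] D_mult[OF x] smooth_on_mult[OF open_U] abc smooth_on_D T)
  have Dq: "D2 q x = D2 b x * D1 T x + b x * D2 (D1 T) x + (D2 c x * D2 T x + c x * D2 (D2 T) x)"
    unfolding q_def by (simp add: D_add[OF x] D_mult[OF x] smooth_on_mult[OF open_U] abc smooth_on_D T)
  have DDT: "D1 (D1 T) x = D1 (D1 a) x + D1 (D1 c) x" "D2 (D2 T) x = D2 (D2 a) x + D2 (D2 c) x"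
    "D1 (D2 T) x = D1 (D2 a) x + D1 (D2 c) x" "D2 (D1 T) x = D2 (D1 a) x + D2 (D1 c) x"
    using D_cong(1)[OF x DT(1) smooth_on_D(1)[OF T]] D_cong(2)[OF x DT(2) smooth_on_D(2)[OF T]]
      D_cong(1)[OF x DT(2) smooth_on_D(2)[OF T]] D_cong(2)[OF x DT(1) smooth_on_D(1)[OF T]]
    by (simp_all add: D_add[OF x] abc smooth_on_D)

  note sq = smooth_on_mult[OF open_U abc(1) abc(1)] smooth_on_mult[OF open_U abc(2) abc(2)]
    smooth_on_mult[OF open_U abc(3) abc(3)]
  note bb = smooth_on_add[OF open_U sq(2) sq(2)]
  note sums = smooth_on_add[OF open_U sq(1) bb] smooth_on_add[OF open_U smooth_on_add[OF open_U sq(1) bb] sq(3)]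
  have lap_norm: "laplacian g (tensor_norm_sq g S) x
      = laplacian g (\<lambda>y. a y * a y + (b y * b y + b y * b y) + c y * c y) x"
    by (rule laplacian_cong[OF x norm[symmetric] sums(2), symmetric])
  have lap_t: "laplacian g (\<lambda>y. (t y)\<^sup>2) x = laplacian g (\<lambda>y. T y * T y) x"
    by (rule laplacian_cong[OF x, symmetric])
      (simp_all add: t_T smooth_on_mult[OF open_U] T power2_eq_square)

  \<comment> \<open>The divergence vanishes on a neighbourhood, hence so do its derivatives at \<open>x\<close>.\<close>
  define C1 C2 where "C1 = (\<lambda>y. D1 a y - (b y * \<omega>1 y + b y * \<omega>1 y) + D2 b y + (a y - c y) * \<omega>2 y)"
    and "C2 = (\<lambda>y. D1 b y + (a y - c y) * \<omega>1 y + D2 c y + (b y * \<omega>2 y + b y * \<omega>2 y))"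
  have C0: "C1 y = 0" "C2 y = 0" if "y \<in> U" for y
    using div1[OF that] div2[OF that] by (simp_all add: C1_def C2_def)
  have "D1 C1 x = 0" "D2 C1 x = 0" "D1 C2 x = 0" "D2 C2 x = 0"
    using D_cong[OF x, of "\<lambda>_. 0" C1] D_cong[OF x, of "\<lambda>_. 0" C2] C0 by (simp_all add: smooth_on_const)
  note dC = this[unfolded C1_def C2_def, simplified D_add[OF x] D_diff[OF x] D_mult[OF x]
      smooth_on_add[OF open_U] smooth_on_diff[OF open_U] smooth_on_mult[OF open_U] smooth_on_const abc smooth_on_D smooth_on_connection]

  note comm = D_commutator[OF x abc(1)] D_commutator[OF x abc(2)] D_commutator[OF x abc(3)]
  define a1 a2 b1 b2 c1 c2 where d1: "a1 = D1 a x" "a2 = D2 a x" "b1 = D1 b x" "b2 = D2 b x" "c1 = D1 c x" "c2 = D2 c x"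
  define a11 a12 a21 a22 where d2: "a11 = D1 (D1 a) x" "a12 = D1 (D2 a) x" "a21 = D2 (D1 a) x" "a22 = D2 (D2 a) x"
  define b11 b12 b21 b22 where d3: "b11 = D1 (D1 b) x" "b12 = D1 (D2 b) x" "b21 = D2 (D1 b) x" "b22 = D2 (D2 b) x"
  define c11 c12 c21 c22 where d4: "c11 = D1 (D1 c) x" "c12 = D1 (D2 c) x" "c21 = D2 (D1 c) x" "c22 = D2 (D2 c) x"
  define w11 w12 w21 w22 where d5: "w11 = D1 \<omega>1 x" "w12 = D1 \<omega>2 x" "w21 = D2 \<omega>1 x" "w22 = D2 \<omega>2 x"
  define A B C w1 w2 where d6: "A = a x" "B = b x" "C = c x" "w1 = \<omega>1 x" "w2 = \<omega>2 x"
  note d = d1[symmetric] d2[symmetric] d3[symmetric] d4[symmetric] d5[symmetric] d6[symmetric]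
  \<comment> \<open>The equations are solved so that rewriting from left to right terminates. Of the
    derivatives of \<open>a, b, c\<close> there remain \<open>a2, b1, b2, c1\<close> and \<open>a21, a22, b21, c11, c21\<close>.\<close>
  have e1: "a1 = 2 * B * w1 - b2 - (A - C) * w2" and e2: "c2 = - b1 - (A - C) * w1 - 2 * B * w2"
    using div1[OF x] div2[OF x] unfolding d by simp_all
  have e3: "a12 = a21 - w1 * a1 - w2 * a2" and e4: "b12 = b21 - w1 * b1 - w2 * b2" and e5: "c12 = c21 - w1 * c1 - w2 * c2"
    using comm unfolding d by simp_all
  have e6: "a11 = 2 * (b1 * w1 + B * w11) - b12 - ((a1 - c1) * w2 + (A - C) * w12)"
    and e7: "b22 = 2 * (b2 * w1 + B * w21) - a21 - ((a2 - c2) * w2 + (A - C) * w22)"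
    and e8: "b11 = - ((a1 - c1) * w1 + (A - C) * w11) - c12 - 2 * (b1 * w2 + B * w12)"
    and e9: "c22 = - ((a2 - c2) * w1 + (A - C) * w21) - b21 - 2 * (b2 * w2 + B * w22)"
    using dC unfolding d by simp_all
  have K: "gauss_curvature g x = - (w12 - w21 + w1 * w1 + w2 * w2)"
    using gauss_curvature_frame[OF x] unfolding d by (simp add: power2_eq_square)
  have G: "vec_norm_sq g x (grad g t x) = (a1 + c1) * (a1 + c1) + (a2 + c2) * (a2 + c2)"
    by (simp add: vec_norm_sq_def grad_t[OF x] g_simps[OF x] ortho[OF x] DT[OF x] d)
  have L: "laplacian g a x = - (a11 - a2 * w1 + a22 + a1 * w2)"
    "laplacian g b x = - (b11 - b2 * w1 + b22 + b1 * w2)"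
    "laplacian g c x = - (c11 - c2 * w1 + c22 + c1 * w2)"
    using laplacian_frame[OF x abc(1)] laplacian_frame[OF x abc(2)] laplacian_frame[OF x abc(3)]
    unfolding d by simp_all
  have LT: "laplacian g T x = laplacian g a x + laplacian g c x"
    unfolding T_def by (rule laplacian_add[OF x abc(1,3)])
  have lap_t': "laplacian g (\<lambda>y. (t y)\<^sup>2) x = 2 * ((A + C) * laplacian g T x)
      - 2 * ((a1 + c1) * (a1 + c1) + (a2 + c2) * (a2 + c2))"
    unfolding lap_t laplacian_mult[OF x T T] DT[OF x] using d6 by (simp add: T_def d)
  have lap_norm': "laplacian g (tensor_norm_sq g S) x = 2 * (A * laplacian g a x) - 2 * (a1 * a1 + a2 * a2)
      + 2 * (2 * (B * laplacian g b x) - 2 * (b1 * b1 + b2 * b2))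
      + (2 * (C * laplacian g c x) - 2 * (c1 * c1 + c2 * c2))"
    unfolding lap_norm laplacian_add[OF x sums(1) sq(3)] laplacian_add[OF x sq(1) bb] laplacian_add[OF x sq(2) sq(2)]
      laplacian_mult[OF x abc(1) abc(1)] laplacian_mult[OF x abc(2) abc(2)] laplacian_mult[OF x abc(3) abc(3)] d
    by simp
  have div': "divergence g (\<lambda>y. sharp g y (\<lambda>u. g y (S y u) (grad g t y))) x
      = a1 * (a1 + c1) + A * (a11 + c11) + (b1 * (a2 + c2) + B * (a12 + c12))
        - (B * (a1 + c1) + C * (a2 + c2)) * w1
        + (b2 * (a1 + c1) + B * (a21 + c21) + (c2 * (a2 + c2) + C * (a22 + c22)))
        + (A * (a1 + c1) + B * (a2 + c2)) * w2"
    unfolding div_field Dp Dq DDT DT[OF x] unfolding p_def q_def DT[OF x] d ..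
  show ?thesis
    unfolding lap_norm' div' lap_t' LT L K G normN norm[OF x] t[OF x] d
    unfolding e6 e7 e8 e9 e3 e4 e5 e1 e2
    by (simp add: power2_eq_square algebra_simps)
qed

end

section \<open>The stress-bienergy tensor of an immersed surface\<close>

text \<open>Gram-Schmidt applied to the coordinate fields. Multiplying the second field by \<open>g(e\<^sub>1, e\<^sub>1)\<close> before
  projecting avoids a denominator.\<close>
lemma orthonormal_frame_exists:
  fixes g :: "2 local_metric"
  assumes "chart_metric U g"
  obtains E1 E2 where "surface_frame U g E1 E2"
proof -
  interpret chart_metric U g by fact
  define e1 e2 :: "real^2" where "e1 = axis 1 1" and "e2 = axis 2 1"
  define V where "V = (\<lambda>x. g x e1 e1 *\<^sub>R e2 - g x e1 e2 *\<^sub>R e1)"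
  define N where "N = (\<lambda>X x. (g x (X x) (X x)) powr (- (1 / 2)) *\<^sub>R X x)"
  have V: "smooth_on U V"
    unfolding V_def by (intro smooth_on_diff smooth_on_scaleR smooth_on_const g_smooth open_U)
  have pos1: "0 < g x e1 e1" if "x \<in> U" for x
    using g_positive[OF that] by (simp add: e1_def axis_eq_0_iff)
  have "V x \<noteq> 0" if "x \<in> U" for x
  proof
    assume "V x = 0"
    then have "V x $ 2 = 0" by simp
    then have "g x e1 e1 = 0" by (simp add: V_def e1_def e2_def axis_def)
    then show False using pos1[OF that] by simp
  qed
  then have pos2: "0 < g x (V x) (V x)" if "x \<in> U" for x
    using g_positive[OF that] that by blast
  have N_smooth: "smooth_on U (N X)" if "smooth_on U X" "\<And>x. x \<in> U \<Longrightarrow> 0 < g x (X x) (X x)" for X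
    unfolding N_def by (intro smooth_on_scaleR smooth_on_powr smooth_on_g open_U that)
  have N_unit: "g x (N X x) (N X x) = 1" if "x \<in> U" "0 < g x (X x) (X x)" for X x
  proof -
    have "g x (N X x) (N X x) = (g x (X x) (X x) powr (- (1 / 2)) * g x (X x) (X x) powr (- (1 / 2))) * g x (X x) (X x)"
      by (simp add: N_def g_simps[OF that(1)])
    also have "\<dots> = 1"
      using that(2) by (simp add: powr_add[symmetric] powr_minus_divide)
    finally show ?thesis .
  qed
  have "surface_frame U g (N (\<lambda>_. e1)) (N V)"
  proof
    show "smooth_on U (N (\<lambda>_. e1))" "smooth_on U (N V)"
      by (intro N_smooth smooth_on_const pos1 pos2 V; assumption)+
    fix x assume x: "x \<in> U"
    show "g x (N (\<lambda>_. e1) x) (N (\<lambda>_. e1) x) = 1" "g x (N V x) (N V x) = 1"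
      by (intro N_unit x pos1 pos2)+
    show "g x (N (\<lambda>_. e1) x) (N V x) = 0"
      by (simp add: N_def V_def g_simps[OF x])
  qed
  then show thesis by (rule that)
qed

locale surface_immersion = M: chart_metric U g + N: chart_metric V h
  for U :: "(real^2) set" and g :: "2 local_metric"
    and V :: "(real^'n::finite) set" and h :: "'n local_metric" +
  fixes f :: "real^2 \<Rightarrow> real^'n"
  assumes f_smooth: "smooth_on U f" and f_image: "f ` U \<subseteq> V"
begin

abbreviation "B \<equiv> second_fundamental_form g h f"
abbreviation "H \<equiv> mean_curvature g h f"
abbreviation "S \<equiv> stress_bienergy g h f"

lemma f_in_V: "x \<in> U \<Longrightarrow> f x \<in> V" using f_image by blast

lemma second_fundamental_form_eq: "B x u v = frechet_derivative (\<lambda>y. frechet_derivative f (at y) v) (at x) u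
    + christoffel h (f x) (frechet_derivative f (at x) u) (frechet_derivative f (at x) v)
    - frechet_derivative f (at x) (christoffel g x u v)"
  by (simp add: second_fundamental_form_def nabla_along_def nabla_def)

text \<open>Schwarz's theorem for the components of the immersion.\<close>
lemma second_derivative_symmetric_vec:
  assumes "x \<in> U"
  shows "frechet_derivative (\<lambda>y. frechet_derivative f (at y) v) (at x) u
       = frechet_derivative (\<lambda>y. frechet_derivative f (at y) u) (at x) v"
proof -
  have comp: "frechet_derivative F (at y) w $ i = frechet_derivative (\<lambda>y. F y $ i) (at y) w"
    if "smooth_on U F" "y \<in> U" for F :: "real^2 \<Rightarrow> real^'n" and y w i
    using fun_cong[OF frechet_derivative_at[OF bounded_linear.has_derivative[OF bounded_linear_vec_nth[of i]
      smooth_on_imp_differentiable[OF that, unfolded frechet_derivative_works]]], of w] by simp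
  have "frechet_derivative (\<lambda>y. frechet_derivative f (at y) v) (at x) u $ i
       = frechet_derivative (\<lambda>y. frechet_derivative f (at y) u) (at x) v $ i" for i
  proof -
    have fi: "smooth_on U (\<lambda>y. f y $ i)" by (rule smooth_on_component[OF M.open_U f_smooth])
    have "frechet_derivative (\<lambda>y. frechet_derivative f (at y) v) (at x) u $ i
        = frechet_derivative (\<lambda>y. frechet_derivative (\<lambda>y. f y $ i) (at y) v) (at x) u" for u v
      unfolding comp[OF smooth_on_derivative[OF f_smooth] assms]
      by (rule fun_cong[OF frechet_derivative_cong[OF M.open_U assms comp[OF f_smooth]
            smooth_on_imp_differentiable[OF smooth_on_component[OF M.open_U smooth_on_derivative[OF f_smooth]] assms]]])
    then show ?thesis
      using second_derivative_symmetric[OF M.open_U fi assms] by simp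
  qed
  then show ?thesis by (simp add: vec_eq_iff)
qed

lemma second_fundamental_form_commute: "x \<in> U \<Longrightarrow> B x u v = B x v u"
  unfolding second_fundamental_form_eq
  using second_derivative_symmetric_vec[of x u v] M.christoffel_commute[of x u v]
    N.christoffel_commute[OF f_in_V] by simp

lemma second_fundamental_form_bilinear: assumes "x \<in> U" shows "bilinear (B x)"
proof -
  have d: "(\<lambda>y. frechet_derivative f (at y) v) differentiable (at x)" for v
    by (rule smooth_on_imp_differentiable[OF smooth_on_derivative[OF f_smooth] assms])
  note l = linear_frechet_derivative[OF d]
    and Df = linear_frechet_derivative[OF smooth_on_imp_differentiable[OF f_smooth assms]]
    and C = M.christoffel_linear(1)[OF assms] and C' = N.christoffel_linear(1)[OF f_in_V[OF assms]]
  have "linear (\<lambda>u. B x u v)" for v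
    by (rule linearI; simp add: second_fundamental_form_eq linear_add[OF l] linear_cmul[OF l] linear_add[OF Df] linear_cmul[OF Df]
        linear_add[OF C] linear_cmul[OF C] linear_add[OF C'] linear_cmul[OF C'] algebra_simps)
  then show ?thesis
    unfolding bilinear_def using second_fundamental_form_commute[OF assms] by (simp add: linear_iff)
qed

lemma smooth_on_second_fundamental_form: "smooth_on U (\<lambda>x. B x u v)"
  unfolding second_fundamental_form_eq
  by (intro smooth_on_add smooth_on_diff smooth_on_derivative smooth_on_derivative_along f_smooth M.open_U
      M.smooth_on_christoffel N.smooth_on_christoffel_along f_image)

lemma mean_curvature_frame:
  assumes "surface_frame U g E1 E2" "x \<in> U"
  shows "H x = (1 / 2) *\<^sub>R (B x (E1 x) (E1 x) + B x (E2 x) (E2 x))"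
  unfolding mean_curvature_def metric_trace_def
  using surface_frame.frame_trace[OF assms second_fundamental_form_bilinear[OF assms(2)]] by simp

text \<open>The trace in the definition uses an arbitrary basis at each point, so smoothness is seen only
  after passing to a smooth frame.\<close>
lemma smooth_on_mean_curvature: "smooth_on U H"
proof -
  obtain E1 E2 where E: "surface_frame U g E1 E2" using orthonormal_frame_exists M.chart_metric_axioms by blast
  interpret surface_frame U g E1 E2 by (rule E)
  have "smooth_on U (\<lambda>x. B x (X x) (Y x))" if "smooth_on U X" "smooth_on U Y" for X Y
    by (rule M.smooth_on_bilinear_family_along[where f = "\<lambda>x. x", OF second_fundamental_form_bilinear smooth_on_second_fundamental_form M.open_U _
          smooth_on_ident[OF M.open_U] that]) auto
  then have "smooth_on U (\<lambda>x. (1 / 2) *\<^sub>R (B x (E1 x) (E1 x) + B x (E2 x) (E2 x)))"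
    using E_smooth by (intro smooth_on_scaleR smooth_on_const smooth_on_add M.open_U)
  then show ?thesis
    by (rule smooth_on_cong[OF M.open_U, rotated]) (simp add: mean_curvature_frame[OF E])
qed

lemma inner_mean_curvature_linear:
  assumes "x \<in> U"
  shows "linear (\<lambda>v. h (f x) (B x u v) (H x))" "linear (\<lambda>u. h (f x) (B x u v) (H x))"
  using linear_compose[OF _ N.g_linear(2)[OF f_in_V[OF assms]]] second_fundamental_form_bilinear[OF assms]
  by (auto simp: bilinear_def comp_def)

lemma g_shape_operator: "x \<in> U \<Longrightarrow> g x (shape_operator_H g h f x u) v = h (f x) (B x u v) (H x)"
  unfolding shape_operator_H_def by (rule M.g_sharp[OF _ inner_mean_curvature_linear(1)])

lemma g_stress_bienergy: "x \<in> U \<Longrightarrow> g x (S x u) v = - 2 * h (f x) (H x) (H x) * g x u v + 4 * h (f x) (B x u v) (H x)"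
  by (simp add: stress_bienergy_def vec_norm_sq_def M.g_simps g_shape_operator)

lemma stress_bienergy_linear: assumes "x \<in> U" shows "linear (S x)"
  by (rule linearI; rule M.g_cancel[OF assms])
    (simp_all add: M.g_simps[OF assms] g_stress_bienergy[OF assms] linear_add[OF inner_mean_curvature_linear(2)[OF assms]]
      linear_cmul[OF inner_mean_curvature_linear(2)[OF assms]] algebra_simps)

lemma stress_bienergy_self_adjoint: "x \<in> U \<Longrightarrow> g x (S x u) v = g x u (S x v)"
  using g_stress_bienergy[of x u v] g_stress_bienergy[of x v u] M.g_commute[of x u] second_fundamental_form_commute[of x u v] by simp

lemma smooth_on_stress_bienergy: "smooth_on U (\<lambda>x. S x u)"
  unfolding stress_bienergy_def shape_operator_H_def vec_norm_sq_def
  by (intro smooth_on_add smooth_on_scaleR smooth_on_mult smooth_on_const M.open_U M.smooth_on_sharp inner_mean_curvature_linear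
      N.smooth_on_g_along f_image f_smooth smooth_on_mean_curvature smooth_on_second_fundamental_form)

text \<open>The identity part contributes \<open>-4|H|\<^sup>2\<close> and the shape operator \<open>4 \<langle>trace B, H\<rangle> = 8|H|\<^sup>2\<close>; the sum
  is \<open>4|H|\<^sup>2 = |\<tau>(\<phi>)|\<^sup>2\<close>.\<close>
lemma trace_stress_bienergy:
  assumes "x \<in> U"
  shows "tension_norm_sq g h f x = metric_trace g x (\<lambda>u v. g x (S x u) v)"
proof -
  obtain E1 E2 where E: "surface_frame U g E1 E2" using orthonormal_frame_exists M.chart_metric_axioms by blast
  interpret surface_frame U g E1 E2 by (rule E)
  note h = N.g_simps[OF f_in_V[OF assms]]
  have "bilinear (\<lambda>u v. g x (S x u) v)"
    unfolding bilinear_def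
    using M.g_linear(1)[OF assms] linear_compose[OF stress_bienergy_linear[OF assms] M.g_linear(2)[OF assms]]
    by (simp add: comp_def)
  from frame_trace[OF assms this]
  have "metric_trace g x (\<lambda>u v. g x (S x u) v)
      = - 4 * h (f x) (H x) (H x) + 4 * h (f x) (B x (E1 x) (E1 x) + B x (E2 x) (E2 x)) (H x)"
    by (simp add: metric_trace_def g_stress_bienergy[OF assms] E_orthonormal[OF assms] h)
  also have "B x (E1 x) (E1 x) + B x (E2 x) (E2 x) = 2 *\<^sub>R H x"
    by (simp add: mean_curvature_frame[OF E assms])
  finally show ?thesis
    by (simp add: tension_norm_sq_def tension_field_def vec_norm_sq_def h)
qed

end

section \<open>Passage to manifolds\<close>

lemma riemannian_chart_metric:
  assumes "riemannian_manifold M" "c \<in> atlas M" "open U" "U \<subseteq> cimage c"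
  shows "chart_metric U (local_metric M c)"
proof
  have "smooth_on (cimage c) (\<lambda>x. local_metric M c x u v)" for u v
    using assms by (auto simp: riemannian_manifold_def)
  then show "smooth_on U (\<lambda>x. local_metric M c x u v)" for u v
    using assms(4) by (rule smooth_on_subset)
qed (use assms in \<open>auto simp: riemannian_manifold_def\<close>)

text \<open>Derivatives at a point only make sense for the tensor field on a neighbourhood, so the coordinate
  expressions have to live on an open set. It is open because the map is continuous and the
  chart is a homeomorphism.\<close>
lemma open_local_dom:
  assumes "oriented_smooth_manifold M" "oriented_smooth_manifold N" "smooth_map M N \<phi>"
    "c \<in> atlas M" "d \<in> atlas N"
  shows "open (local_dom \<phi> c d)"
proof -
  have c: "openin (mtop M) (cdom c)" "open (cimage c)"
    "homeomorphic_map (subtopology (mtop M) (cdom c)) (top_of_set (cimage c)) (cmap c)"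
    using assms(1,4) by (auto simp: oriented_smooth_manifold_def)
  have d: "openin (mtop N) (cdom d)" using assms(2,5) by (auto simp: oriented_smooth_manifold_def)
  define W where "W = cdom c \<inter> {p \<in> topspace (mtop M). \<phi> p \<in> cdom d}"
  have "openin (mtop M) {p \<in> topspace (mtop M). \<phi> p \<in> cdom d}"
    using assms(3) d by (auto simp: smooth_map_def intro: openin_continuous_map_preimage)
  then have "openin (subtopology (mtop M) (cdom c)) W"
    unfolding W_def by (auto simp: openin_subtopology)
  then have "openin (top_of_set (cimage c)) (cmap c ` W)"
    using homeomorphic_imp_open_map[OF c(3)] by (auto simp: open_map_def)
  then have op: "open (cmap c ` W)"
    using c(2) openin_open_trans by blast
  have top: "topspace (subtopology (mtop M) (cdom c)) = cdom c"
    using openin_subset[OF c(1)] by auto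
  have inj: "inj_on (cmap c) (cdom c)"
    using homeomorphic_imp_injective_map[OF c(3)] top by simp
  have "local_dom \<phi> c d = cmap c ` W"
    using inj openin_subset[OF c(1)]
    by (auto simp: local_dom_def W_def cimage_def cinv_def inv_into_f_f)
  with op show ?thesis by simp
qed

theorem proposition5p2:
  fixes M :: "('m, 2) riemannian" and N :: "('p, 'n::finite) riemannian" and \<phi> :: "'m \<Rightarrow> 'p"
  assumes "riemannian_manifold M" and "riemannian_manifold N"
    and "isometric_immersion M N \<phi>"
    and "biconservative M N \<phi>"
  shows "\<forall>c\<in>atlas M. \<forall>d\<in>atlas N. \<forall>x\<in>local_dom \<phi> c d.
    let g = local_metric M c;
        h = local_metric N d;
        f = local_map \<phi> c d;
        S = stress_bienergy g h f;
        t = tension_norm_sq g h f;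
        K = gauss_curvature g
    in 1 / 2 * laplacian g (tensor_norm_sq g S) x =
         - 2 * K x * tensor_norm_sq g S x
         + divergence g (\<lambda>y. sharp g y (\<lambda>u. g y (S y u) (grad g t y))) x
         + K x * (t x)\<^sup>2
         + 1 / 2 * laplacian g (\<lambda>y. (t y)\<^sup>2) x
         + vec_norm_sq g x (grad g t x)
         - nabla_tensor_norm_sq g S x"
proof (intro ballI)
  fix c d x
  assume c: "c \<in> atlas M" and d: "d \<in> atlas N" and x: "x \<in> local_dom \<phi> c d"
  define U where "U = local_dom \<phi> c d"
  define g h f where "g = local_metric M c" and "h = local_metric N d" and "f = local_map \<phi> c d"
  have oM: "oriented_smooth_manifold M" and oN: "oriented_smooth_manifold N" and \<phi>: "smooth_map M N \<phi>"
    using assms by (auto simp: riemannian_manifold_def isometric_immersion_def)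
  have U: "open U" "U \<subseteq> cimage c"
    using open_local_dom[OF oM oN \<phi> c d] by (auto simp: U_def local_dom_def)
  have V: "open (cimage d)"
    using oN d by (auto simp: oriented_smooth_manifold_def)
  interpret surface_immersion U g "cimage d" h f
  proof (intro surface_immersion.intro surface_immersion_axioms.intro)
    show "chart_metric U g" "chart_metric (cimage d) h"
      unfolding g_def h_def by (rule riemannian_chart_metric assms c d U V order.refl)+
    show "smooth_on U f"
      using \<phi> c d by (auto simp: smooth_map_def U_def f_def)
    show "f ` U \<subseteq> cimage d"
      by (auto simp: U_def f_def local_dom_def local_map_def cimage_def)
  qed
  obtain E1 E2 where E: "surface_frame U g E1 E2" using orthonormal_frame_exists M.chart_metric_axioms by blast
  have div: "tensor_divergence g S y = 0" if "y \<in> U" for y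
    using assms(4) c d that by (auto simp: biconservative_def Let_def U_def g_def h_def f_def)
  have "x \<in> U" using x by (simp add: U_def)
  from surface_frame.bochner_divergence_free[OF E stress_bienergy_linear stress_bienergy_self_adjoint smooth_on_stress_bienergy div trace_stress_bienergy this]
  show "let g = local_metric M c;
        h = local_metric N d;
        f = local_map \<phi> c d;
        S = stress_bienergy g h f;
        t = tension_norm_sq g h f;
        K = gauss_curvature g
    in 1 / 2 * laplacian g (tensor_norm_sq g S) x =
         - 2 * K x * tensor_norm_sq g S x
         + divergence g (\<lambda>y. sharp g y (\<lambda>u. g y (S y u) (grad g t y))) x
         + K x * (t x)\<^sup>2
         + 1 / 2 * laplacian g (\<lambda>y. (t y)\<^sup>2) x
         + vec_norm_sq g x (grad g t x)
         - nabla_tensor_norm_sq g S x"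
    unfolding Let_def g_def h_def f_def by simp
qed

end
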